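(* Let $\mathcal{A}$ be the universal $C^*$-algebra generated by isometries $s$, $t$ and $\{\upsilon_p : p \text{ prime}\}$ satisfying the following relations (for all primes $p,q$): (R1) $t^2=s^3$; (R2) $ts=st$, $s^*t=ts^*$, and $t^*s=st^*$; (T1) $\upsilon_p s=s^p\upsilon_p$, $\upsilon_p t=t^p\upsilon_p$, $\upsilon_p s^*=s^{*p}\upsilon_p$, and $\upsilon_p t^*=t^{*p}\upsilon_p$; (T2) $\upsilon_p\upsilon_q=\upsilon_q\upsilon_p$; (T3) $\upsilon_p^*\upsilon_q=\upsilon_q\upsilon_p^*$ when $p\neq q$; (T4) $s^*\upsilon_p=s^{p-1}\upsilon_p s^*$; (T5) $\upsilon_p^*s^{k_1}t^{k_2}\upsilon_p=0$ for $k_1,k_2\in\mathbb{N}$ with $1\le 2k_1+3k_2<p$; (T6) $\upsilon_p^*s^k\upsilon_p=0$ for $1\le k<p$ when $p\ne 2$, and $\upsilon_2^*s\upsilon_2=ts^*$; $\upsilon_p^*t^k\upsilon_p=0$ for $1\le k<p$ when $p\neq 3$, $\upsilon_3^*t\upsilon_3=ts^*$, $\upsilon_3^*t^2\upsilon_3=s$; and $\upsilon_p^*t^ks^{*k}\upsilon_p=0$ for $1\le k<p$. Then there is an isomorphism $\pi$ of $\mathcal{T}(\mathrm{P}\rtimes\mathbb{N}^{\times})$ onto $\mathcal{A}$ such that $\pi(W_{(2,1)})=s$, $\pi(W_{(3,1)})=t$, and $\pi(W_{(0,p)})=\upsilon_p$ for every prime $p$.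
   Context: $\mathbb{N}=\{0,1,2,\dots\}$, $\mathbb{N}^{\times}$ is the multiplicative semigroup of positive integers, and $\mathrm{P}=\{0,2,3,4,\dots\}$ is an additive semigroup. $\mathrm{P}\rtimes\mathbb{N}^{\times}$ is the semigroup of pairs $(m,a)$, $m\in \mathrm{P}$, $a\in\mathbb{N}^\times$, with product $(m,a)(n,b)=(m+an,ab)$ and unit $(0,1)$. For $(m,a),(n,b)\in\mathrm{P}\rtimes\mathbb{N}^{\times}$ put $(m,a)\Cup(n,b)=\infty$ if $(m+a\mathrm{P})\cap(n+b\mathrm{P})=\emptyset$, and otherwise $(m,a)\Cup(n,b)=(\ell,\mathrm{lcm}(a,b))$, where $\ell$ is the smallest element (usual order) of $(m+a\mathrm{P})\cap(n+b\mathrm{P})$. An isometric representation $W$ of $\mathrm{P}\rtimes\mathbb{N}^{\times}$ is a map into the isometries (on a Hilbert space, or in a unital $C^*$-algebra) with $W_{(0,1)}=1$ and $W_{xy}=W_xW_y$. It is covariant if $W_{(m,a)}W_{(m,a)}^*W_{(n,b)}W_{(n,b)}^*=W_{(m,a)\Cup(n,b)}W_{(m,a)\Cup(n,b)}^*$ for all $(m,a),(n,b)$, with the convention $W_\infty=0$. $\mathcal{T}(\mathrm{P}\rtimes\mathbb{N}^{\times})$ is the $C^*$-algebra generated by a covariant isometric representation $W:\mathrm{P}\rtimes\mathbb{N}^\times\to\mathcal{T}(\mathrm{P}\rtimes\mathbb{N}^{\times})$ (the canonical one) that is universal: for every covariant isometric representation $X$ there is a homomorphism $\pi:\mathcal{T}(\mathrm{P}\rtimes\mathbb{N}^{\times})\to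 C^*(\{X_{(m,a)}\})$ with $\pi(W_{(m,a)})=X_{(m,a)}$. *)

theory Defs
  imports Complex_Main "HOL-Algebra.Algebraic_Closure_Type"
begin

hide_const (open) Divisibility.prime

section \<open>Unital C*-algebras with an explicit carrier\<close>

record 'a cstar = "(complex, 'a) module" +
  adj :: "'a \<Rightarrow> 'a"  (\<open>_\<^sup>\<star>\<index>\<close> [1000] 999)
  cnorm :: "'a \<Rightarrow> real"  (\<open>\<parallel>_\<parallel>\<index>\<close>)

text \<open>The zero algebra is allowed, since \<open>\<parallel>\<one>\<parallel> = 1\<close> is not assumed.\<close>

locale cstar_algebra =
  ring A + scalar: module "ring_of_type_algebra :: complex ring" A
  for A :: "'a cstar" (structure) +
  assumes smult_mult_left: "\<lbrakk>x \<in> carrier A; y \<in> carrier A\<rbrakk> \<Longrightarrow> (c \<odot> x) \<otimes> y = c \<odot> (x \<otimes> y)"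
    and smult_mult_right: "\<lbrakk>x \<in> carrier A; y \<in> carrier A\<rbrakk> \<Longrightarrow> x \<otimes> (c \<odot> y) = c \<odot> (x \<otimes> y)"
    and adj_closed: "x \<in> carrier A \<Longrightarrow> x\<^sup>\<star> \<in> carrier A"
    and adj_adj: "x \<in> carrier A \<Longrightarrow> (x\<^sup>\<star>)\<^sup>\<star> = x"
    and adj_add: "\<lbrakk>x \<in> carrier A; y \<in> carrier A\<rbrakk> \<Longrightarrow> (x \<oplus> y)\<^sup>\<star> = x\<^sup>\<star> \<oplus> y\<^sup>\<star>"
    and adj_smult: "x \<in> carrier A \<Longrightarrow> (c \<odot> x)\<^sup>\<star> = cnj c \<odot> x\<^sup>\<star>"
    and adj_mult: "\<lbrakk>x \<in> carrier A; y \<in> carrier A\<rbrakk> \<Longrightarrow> (x \<otimes> y)\<^sup>\<star> = y\<^sup>\<star> \<otimes> x\<^sup>\<star>"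
    and cnorm_nonneg: "x \<in> carrier A \<Longrightarrow> 0 \<le> \<parallel>x\<parallel>"
    and cnorm_eq_0: "x \<in> carrier A \<Longrightarrow> \<parallel>x\<parallel> = 0 \<longleftrightarrow> x = \<zero>"
    and cnorm_triangle: "\<lbrakk>x \<in> carrier A; y \<in> carrier A\<rbrakk> \<Longrightarrow> \<parallel>x \<oplus> y\<parallel> \<le> \<parallel>x\<parallel> + \<parallel>y\<parallel>"
    and cnorm_smult: "x \<in> carrier A \<Longrightarrow> \<parallel>c \<odot> x\<parallel> = cmod c * \<parallel>x\<parallel>"
    and cnorm_mult: "\<lbrakk>x \<in> carrier A; y \<in> carrier A\<rbrakk> \<Longrightarrow> \<parallel>x \<otimes> y\<parallel> \<le> \<parallel>x\<parallel> * \<parallel>y\<parallel>"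
    and cstar_identity: "x \<in> carrier A \<Longrightarrow> \<parallel>x\<^sup>\<star> \<otimes> x\<parallel> = \<parallel>x\<parallel>\<^sup>2"
    and complete: "\<lbrakk>\<And>n. f n \<in> carrier A;
        \<And>e. 0 < e \<Longrightarrow> \<exists>N. \<forall>m\<ge>N. \<forall>n\<ge>N. \<parallel>f m \<ominus> f n\<parallel> < e\<rbrakk>
      \<Longrightarrow> \<exists>l\<in>carrier A. (\<lambda>n. \<parallel>f n \<ominus> l\<parallel>) \<longlonglongrightarrow> 0"

text \<open>C*-subalgebras (norm-closed *-subalgebras), not required to contain the unit of \<open>A\<close>.\<close>

definition cstar_subalgebra :: "'a cstar \<Rightarrow> 'a set \<Rightarrow> bool" where
  "cstar_subalgebra A S \<longleftrightarrow>
     S \<subseteq> carrier A \<and> \<zero>\<^bsub>A\<^esub> \<in> S \<and>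
     (\<forall>x\<in>S. \<forall>y\<in>S. x \<oplus>\<^bsub>A\<^esub> y \<in> S \<and> x \<otimes>\<^bsub>A\<^esub> y \<in> S) \<and>
     (\<forall>x\<in>S. x\<^sup>\<star>\<^bsub>A\<^esub> \<in> S \<and> (\<forall>c. c \<odot>\<^bsub>A\<^esub> x \<in> S)) \<and>
     (\<forall>f. \<forall>l\<in>carrier A. (\<forall>n. f n \<in> S) \<and> (\<lambda>n. \<parallel>f n \<ominus>\<^bsub>A\<^esub> l\<parallel>\<^bsub>A\<^esub>) \<longlonglongrightarrow> 0 \<longrightarrow> l \<in> S)"

definition cstar_generated :: "'a cstar \<Rightarrow> 'a set \<Rightarrow> 'a set" where
  "cstar_generated A G = cstar_subalgebra A hull G"

text \<open>\<open>ring_hom\<close> includes preservation of units. Every homomorphism considered below maps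
  isometries to isometries, so it satisfies this automatically.\<close>

definition star_hom :: "'a cstar \<Rightarrow> 'b cstar \<Rightarrow> ('a \<Rightarrow> 'b) set" where
  "star_hom A B = {\<pi> \<in> ring_hom A B.
     (\<forall>x\<in>carrier A. \<pi> (x\<^sup>\<star>\<^bsub>A\<^esub>) = (\<pi> x)\<^sup>\<star>\<^bsub>B\<^esub> \<and> (\<forall>c. \<pi> (c \<odot>\<^bsub>A\<^esub> x) = c \<odot>\<^bsub>B\<^esub> \<pi> x))}"

definition star_iso :: "'a cstar \<Rightarrow> 'b cstar \<Rightarrow> ('a \<Rightarrow> 'b) set" where
  "star_iso A B = {\<pi> \<in> star_hom A B. bij_betw \<pi> (carrier A) (carrier B)}"

definition isometry_in :: "'a cstar \<Rightarrow> 'a \<Rightarrow> bool" where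
  "isometry_in A x \<longleftrightarrow> x \<in> carrier A \<and> x\<^sup>\<star>\<^bsub>A\<^esub> \<otimes>\<^bsub>A\<^esub> x = \<one>\<^bsub>A\<^esub>"


section \<open>The semigroup and its covariant isometric representations\<close>

definition P_add :: "nat set" where
  "P_add = {n. n \<noteq> 1}"

definition PN :: "(nat \<times> nat) set" where
  "PN = P_add \<times> {a. 0 < a}"

fun pn_mult :: "nat \<times> nat \<Rightarrow> nat \<times> nat \<Rightarrow> nat \<times> nat" where
  "pn_mult (m, a) (n, b) = (m + a * n, a * b)"

definition translate :: "nat \<Rightarrow> nat \<Rightarrow> nat set" where
  "translate m a = {m + a * k | k. k \<in> P_add}"

text \<open>The value \<open>None\<close> stands for \<open>\<infinity>\<close>.\<close>

fun pn_join :: "nat \<times> nat \<Rightarrow> nat \<times> nat \<Rightarrow> (nat \<times> nat) option" where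
  "pn_join (m, a) (n, b) =
     (if translate m a \<inter> translate n b = {} then None
      else Some (LEAST l. l \<in> translate m a \<inter> translate n b, lcm a b))"

text \<open>Only the values of a representation on \<open>PN\<close> matter.\<close>

definition isometric_rep :: "'a cstar \<Rightarrow> (nat \<times> nat \<Rightarrow> 'a) \<Rightarrow> bool" where
  "isometric_rep A W \<longleftrightarrow>
     (\<forall>x\<in>PN. isometry_in A (W x)) \<and> W (0, 1) = \<one>\<^bsub>A\<^esub> \<and>
     (\<forall>x\<in>PN. \<forall>y\<in>PN. W (pn_mult x y) = W x \<otimes>\<^bsub>A\<^esub> W y)"

definition covariant_rep :: "'a cstar \<Rightarrow> (nat \<times> nat \<Rightarrow> 'a) \<Rightarrow> bool" where
  "covariant_rep A W \<longleftrightarrow> isometric_rep A W \<and>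
     (\<forall>x\<in>PN. \<forall>y\<in>PN.
        W x \<otimes>\<^bsub>A\<^esub> (W x)\<^sup>\<star>\<^bsub>A\<^esub> \<otimes>\<^bsub>A\<^esub> W y \<otimes>\<^bsub>A\<^esub> (W y)\<^sup>\<star>\<^bsub>A\<^esub> =
        (case pn_join x y of None \<Rightarrow> \<zero>\<^bsub>A\<^esub> | Some z \<Rightarrow> W z \<otimes>\<^bsub>A\<^esub> (W z)\<^sup>\<star>\<^bsub>A\<^esub>))"

text \<open>A definition in HOL cannot quantify over types, so universality is tested against all
  C*-algebras whose carrier is a set of elements of the type given as the first argument.
  The usual universal property is the conjunction of these over all types. A theorem that
  assumes one instance is therefore stronger than one that assumes the usual property.\<close>

definition universal_covariant_rep ::
    "'b itself \<Rightarrow> 'a cstar \<Rightarrow> (nat \<times> nat \<Rightarrow> 'a) \<Rightarrow> bool" where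
  "universal_covariant_rep TYPE('b) T W \<longleftrightarrow>
     cstar_algebra T \<and> covariant_rep T W \<and> carrier T = cstar_generated T (W ` PN) \<and>
     (\<forall>(B :: 'b cstar) V. cstar_algebra B \<and> covariant_rep B V \<longrightarrow>
        (\<exists>\<pi>\<in>star_hom T B. \<pi> ` carrier T \<subseteq> cstar_generated B (V ` PN) \<and>
           (\<forall>x\<in>PN. \<pi> (W x) = V x)))"


section \<open>The presentation\<close>

text \<open>Only the values of \<open>v\<close> at primes matter. In \<open>T4\<close> the difference \<open>p - 1\<close> is not truncated,
  as \<open>p\<close> is prime.\<close>

locale presentation_relations =
  fixes A :: "'a cstar" (structure) and s t :: 'a and v :: "nat \<Rightarrow> 'a"
  assumes isometry_s: "isometry_in A s"
    and isometry_t: "isometry_in A t"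
    and isometry_v: "prime p \<Longrightarrow> isometry_in A (v p)"
    and R1: "t [^] (2::nat) = s [^] (3::nat)"
    and R2: "t \<otimes> s = s \<otimes> t" "s\<^sup>\<star> \<otimes> t = t \<otimes> s\<^sup>\<star>" "t\<^sup>\<star> \<otimes> s = s \<otimes> t\<^sup>\<star>"
    and T1: "prime p \<Longrightarrow> v p \<otimes> s = s [^] p \<otimes> v p"
            "prime p \<Longrightarrow> v p \<otimes> t = t [^] p \<otimes> v p"
            "prime p \<Longrightarrow> v p \<otimes> s\<^sup>\<star> = (s\<^sup>\<star>) [^] p \<otimes> v p"
            "prime p \<Longrightarrow> v p \<otimes> t\<^sup>\<star> = (t\<^sup>\<star>) [^] p \<otimes> v p"
    and T2: "\<lbrakk>prime p; prime q\<rbrakk> \<Longrightarrow> v p \<otimes> v q = v q \<otimes> v p"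
    and T3: "\<lbrakk>prime p; prime q; p \<noteq> q\<rbrakk> \<Longrightarrow> (v p)\<^sup>\<star> \<otimes> v q = v q \<otimes> (v p)\<^sup>\<star>"
    and T4: "prime p \<Longrightarrow> s\<^sup>\<star> \<otimes> v p = s [^] (p - 1) \<otimes> v p \<otimes> s\<^sup>\<star>"
    and T5: "\<lbrakk>prime p; 1 \<le> 2 * k1 + 3 * k2; 2 * k1 + 3 * k2 < p\<rbrakk>
               \<Longrightarrow> (v p)\<^sup>\<star> \<otimes> s [^] (k1::nat) \<otimes> t [^] (k2::nat) \<otimes> v p = \<zero>"
    and T6: "\<lbrakk>prime p; p \<noteq> 2; 1 \<le> k; k < p\<rbrakk> \<Longrightarrow> (v p)\<^sup>\<star> \<otimes> s [^] k \<otimes> v p = \<zero>"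
            "(v 2)\<^sup>\<star> \<otimes> s \<otimes> v 2 = t \<otimes> s\<^sup>\<star>"
            "\<lbrakk>prime p; p \<noteq> 3; 1 \<le> k; k < p\<rbrakk> \<Longrightarrow> (v p)\<^sup>\<star> \<otimes> t [^] k \<otimes> v p = \<zero>"
            "(v 3)\<^sup>\<star> \<otimes> t \<otimes> v 3 = t \<otimes> s\<^sup>\<star>"
            "(v 3)\<^sup>\<star> \<otimes> t [^] (2::nat) \<otimes> v 3 = s"
            "\<lbrakk>prime p; 1 \<le> k; k < p\<rbrakk> \<Longrightarrow> (v p)\<^sup>\<star> \<otimes> t [^] k \<otimes> (s\<^sup>\<star>) [^] k \<otimes> v p = \<zero>"

definition universal_presentation ::
    "'b itself \<Rightarrow> 'a cstar \<Rightarrow> 'a \<Rightarrow> 'a \<Rightarrow> (nat \<Rightarrow> 'a) \<Rightarrow> bool" where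
  "universal_presentation TYPE('b) A s t v \<longleftrightarrow>
     cstar_algebra A \<and> presentation_relations A s t v \<and>
     carrier A = cstar_generated A ({s, t} \<union> v ` {p. prime p}) \<and>
     (\<forall>(B :: 'b cstar) s' t' v'. cstar_algebra B \<and> presentation_relations B s' t' v' \<longrightarrow>
        (\<exists>\<pi>\<in>star_hom A B. \<pi> s = s' \<and> \<pi> t = t' \<and> (\<forall>p. prime p \<longrightarrow> \<pi> (v p) = v' p)))"

end

theory Submission
  imports Defs
begin

text \<open>
  The relations on \<open>s\<close> and \<open>t\<close> are much stronger than they look. From \<open>t\<^sup>2 = s\<^sup>3\<close> and
  \<open>t\<^sup>\<star>s = st\<^sup>\<star>\<close> one gets \<open>t = t\<^sup>\<star>t\<^sup>2 = t\<^sup>\<star>s\<^sup>3 = s\<^sup>3t\<^sup>\<star> = t\<^sup>2t\<^sup>\<star>\<close>, hence \<open>1 = tt\<^sup>\<star>\<close>: the isometry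
  \<open>t\<close> is unitary, and so is \<open>s\<close> because \<open>s\<^sup>3 = t\<^sup>2\<close> (\<open>unitary_from_cube_relation\<close>). The
  same two relations hold for \<open>W (2, 1)\<close> and \<open>W (3, 1)\<close> in every covariant isometric
  representation, the second one because \<open>(2, 1)\<close> and \<open>(3, 1)\<close> have join \<open>(5, 1)\<close>. So on both sides the additive
  part is generated by one unitary \<open>u = ts\<^sup>\<star>\<close> with \<open>u\<^sup>2 = s\<close> and \<open>u\<^sup>3 = t\<close>, and the gap in
  \<open>P = {0, 2, 3, \<dots>}\<close> disappears.

  Given the relations, let \<open>V a\<close> be the product of the \<open>v p\<close> over the prime factors of \<open>a\<close>
  and put \<open>W (m, a) = u\<^sup>m V a\<close>. Then \<open>V a u = u\<^sup>a V a\<close>, and \<open>W\<close> is an isometric representation.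
  Its range projections \<open>E m a\<close> depend on \<open>m\<close> only modulo \<open>a\<close>, because \<open>u\<close> is unitary. Hence
  \<open>E m a E n b = E l (lcm a b)\<close> for every common element \<open>l\<close> of the two progressions, whether
  it is the least one or not; and the product is zero when the progressions are disjoint,
  because then \<open>g = gcd a b\<close> does not divide \<open>n - m\<close>, and the compression \<open>(V g)\<^sup>\<star> u\<^sup>k V g\<close>
  vanishes unless \<open>g\<close> divides \<open>k\<close>. This is
  \<open>covariant_rep_W\<close>.

  Given a covariant representation, the relations follow by computing a few products
  \<open>(W x)\<^sup>\<star> W y\<close> from joins, with unitarity of \<open>s\<close> and \<open>t\<close> taking care of the adjoints
  (\<open>relations\<close>).

  The two universal properties then give homomorphisms in both directions whose composites fix
  the generators. That they are the identity needs continuity, which is not part of the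
  definition of a *-homomorphism. It is automatic (\<open>star_hom_contractive\<close>): a self-adjoint
  \<open>h\<close> of norm below one is the real part of a unitary, and a unital *-homomorphism maps
  unitaries to unitaries, whose norm is at most one.
\<close>

section \<open>Norm and limits in a C*-algebra\<close>

context cstar_algebra
begin

lemma smult_closed' [simp, intro]: "x \<in> carrier A \<Longrightarrow> c \<odot> x \<in> carrier A"
  by (rule scalar.smult_closed) (auto simp: ring_of_type_algebra_def)

lemma smult_add_left: "x \<in> carrier A \<Longrightarrow> (a + b) \<odot> x = a \<odot> x \<oplus> b \<odot> x"
  using scalar.smult_l_distr[of a b x] by (simp add: ring_of_type_algebra_def)

lemma smult_add_right: "\<lbrakk>x \<in> carrier A; y \<in> carrier A\<rbrakk> \<Longrightarrow> c \<odot> (x \<oplus> y) = c \<odot> x \<oplus> c \<odot> y"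
  using scalar.smult_r_distr[of c x y] by (simp add: ring_of_type_algebra_def)

lemma smult_smult: "x \<in> carrier A \<Longrightarrow> a \<odot> (b \<odot> x) = (a * b) \<odot> x"
  using scalar.smult_assoc1[of a b x] by (simp add: ring_of_type_algebra_def)

lemma smult_1 [simp]: "x \<in> carrier A \<Longrightarrow> 1 \<odot> x = x"
  using scalar.smult_one[of x] by (simp add: ring_of_type_algebra_def)

declare adj_closed [simp, intro] adj_adj [simp]

lemma norm_zero [simp]: "\<parallel>\<zero>\<parallel> = 0"
  by (simp add: cnorm_eq_0)

lemma smult_zero_left [simp]: "x \<in> carrier A \<Longrightarrow> 0 \<odot> x = \<zero>"
  using cnorm_eq_0[of "0 \<odot> x"] by (simp add: cnorm_smult)

lemma smult_minus_one: assumes "x \<in> carrier A" shows "(-1) \<odot> x = \<ominus> x"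
proof -
  have "(-1) \<odot> x \<oplus> x = \<zero>"
    using smult_add_left[OF assms, of "-1" 1] assms by simp
  then show ?thesis
    using assms by (simp add: minus_equality)
qed

lemma smult_minus_right:
  "\<lbrakk>x \<in> carrier A; y \<in> carrier A\<rbrakk> \<Longrightarrow> c \<odot> (x \<ominus> y) = c \<odot> x \<ominus> c \<odot> y"
  by (simp add: minus_eq smult_add_right smult_minus_one[symmetric] smult_smult mult.commute)

lemma adj_minus: "\<lbrakk>x \<in> carrier A; y \<in> carrier A\<rbrakk> \<Longrightarrow> (x \<ominus> y)\<^sup>\<star> = x\<^sup>\<star> \<ominus> y\<^sup>\<star>"
  by (simp add: minus_eq adj_add smult_minus_one[symmetric] adj_smult)

lemma norm_minus_commute:
  assumes "x \<in> carrier A" "y \<in> carrier A" shows "\<parallel>x \<ominus> y\<parallel> = \<parallel>y \<ominus> x\<parallel>"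
proof -
  have "x \<ominus> y = (-1) \<odot> (y \<ominus> x)"
    using assms by (simp add: smult_minus_one minus_eq minus_add a_comm)
  then show ?thesis
    using assms by (simp add: cnorm_smult)
qed

lemma adj_zero [simp]: "\<zero>\<^sup>\<star> = \<zero>"
  using adj_smult[of \<zero> 0] by simp

lemma adj_one [simp]: "\<one>\<^sup>\<star> = \<one>"
  using adj_mult[of "\<one>\<^sup>\<star>" \<one>] by simp

text \<open>The C*-identity gives \<open>\<parallel>x\<parallel>\<^sup>2 = \<parallel>x\<^sup>\<star>x\<parallel> \<le> \<parallel>x\<^sup>\<star>\<parallel> \<parallel>x\<parallel>\<close>; the roles of \<open>x\<close> and \<open>x\<^sup>\<star>\<close> can be
  exchanged.\<close>

lemma norm_adj [simp]: assumes x: "x \<in> carrier A" shows "\<parallel>x\<^sup>\<star>\<parallel> = \<parallel>x\<parallel>"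
proof -
  have le: "\<parallel>y\<parallel> \<le> \<parallel>y\<^sup>\<star>\<parallel>" if y: "y \<in> carrier A" for y
  proof (cases "\<parallel>y\<parallel> = 0")
    case True
    then show ?thesis using y by (simp add: cnorm_nonneg)
  next
    case False
    have "\<parallel>y\<parallel> * \<parallel>y\<parallel> \<le> \<parallel>y\<^sup>\<star>\<parallel> * \<parallel>y\<parallel>"
      using cnorm_mult[of "y\<^sup>\<star>" y] cstar_identity[of y] y by (simp add: power2_eq_square)
    then show ?thesis
      using False cnorm_nonneg[OF y] by (simp add: mult_le_cancel_right)
  qed
  from le[of x] le[of "x\<^sup>\<star>"] x show ?thesis by simp
qed

text \<open>Only an inequality, since in the zero algebra \<open>\<one>\<close> has norm \<open>0\<close>.\<close>

lemma norm_isometry_le: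
  assumes u: "u \<in> carrier A" "u\<^sup>\<star> \<otimes> u = \<one>" shows "\<parallel>u\<parallel> \<le> 1"
proof -
  have "\<parallel>\<one>\<parallel> = \<parallel>\<one>\<parallel>\<^sup>2"
    using cstar_identity[of \<one>] by simp
  then have "\<parallel>\<one>\<parallel> \<le> 1"
    by (auto simp: power2_eq_square)
  then have "\<parallel>u\<parallel>\<^sup>2 \<le> 1"
    using cstar_identity[of u] u by simp
  then show ?thesis
    by (simp add: abs_square_le_1 abs_le_iff)
qed

definition converges_to :: "(nat \<Rightarrow> 'a) \<Rightarrow> 'a \<Rightarrow> bool" where
  "converges_to f l \<longleftrightarrow> (\<lambda>n. \<parallel>f n \<ominus> l\<parallel>) \<longlonglongrightarrow> 0"

lemma converges_to_bound:
  assumes "\<And>n. \<parallel>f n \<ominus> l\<parallel> \<le> g n" "g \<longlonglongrightarrow> 0" "\<And>n. f n \<in> carrier A" "l \<in> carrier A"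
  shows "converges_to f l"
  unfolding converges_to_def
  by (rule tendsto_sandwich[OF _ _ tendsto_const assms(2)]) (auto simp: assms cnorm_nonneg)

lemma converges_to_Suc: "converges_to f l \<Longrightarrow> converges_to (\<lambda>n. f (Suc n)) l"
  unfolding converges_to_def by (rule LIMSEQ_Suc)

lemma norm_triangle_minus:
  assumes "x \<in> carrier A" "y \<in> carrier A" "z \<in> carrier A"
  shows "\<parallel>x \<ominus> z\<parallel> \<le> \<parallel>x \<ominus> y\<parallel> + \<parallel>y \<ominus> z\<parallel>"
proof -
  have "x \<ominus> z = (x \<ominus> y) \<oplus> (y \<ominus> z)"
    using assms by algebra
  then show ?thesis
    using assms by (simp add: cnorm_triangle)
qed

lemma converges_to_unique:
  assumes f: "\<And>n. f n \<in> carrier A" and l: "l \<in> carrier A" "converges_to f l"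
    and k: "k \<in> carrier A" "converges_to f k"
  shows "l = k"
proof -
  have "\<parallel>l \<ominus> k\<parallel> \<le> \<parallel>f n \<ominus> l\<parallel> + \<parallel>f n \<ominus> k\<parallel>" for n
    using norm_triangle_minus[of l "f n" k] f l k by (simp add: norm_minus_commute)
  moreover have "(\<lambda>n. \<parallel>f n \<ominus> l\<parallel> + \<parallel>f n \<ominus> k\<parallel>) \<longlonglongrightarrow> 0 + 0"
    using l k unfolding converges_to_def by (intro tendsto_add)
  ultimately have "\<parallel>l \<ominus> k\<parallel> \<le> 0"
    using LIMSEQ_le_const[of _ "0 + 0" "\<parallel>l \<ominus> k\<parallel>"] by auto
  then have "l \<ominus> k = \<zero>"
    using cnorm_nonneg[of "l \<ominus> k"] cnorm_eq_0[of "l \<ominus> k"] l k by simp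
  moreover have "l = (l \<ominus> k) \<oplus> k"
    using l k by algebra
  ultimately show ?thesis
    using k by simp
qed

lemma norm_mult_minus_mult:
  assumes "a \<in> carrier A" "b \<in> carrier A" "c \<in> carrier A" "d \<in> carrier A"
  shows "\<parallel>a \<otimes> b \<ominus> c \<otimes> d\<parallel> \<le> \<parallel>a\<parallel> * \<parallel>b \<ominus> d\<parallel> + \<parallel>a \<ominus> c\<parallel> * \<parallel>d\<parallel>"
proof -
  have "a \<otimes> b \<ominus> c \<otimes> d = a \<otimes> (b \<ominus> d) \<oplus> (a \<ominus> c) \<otimes> d"
    using assms by algebra
  then have "\<parallel>a \<otimes> b \<ominus> c \<otimes> d\<parallel> \<le> \<parallel>a \<otimes> (b \<ominus> d)\<parallel> + \<parallel>(a \<ominus> c) \<otimes> d\<parallel>"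
    using assms by (simp add: cnorm_triangle)
  also have "\<dots> \<le> \<parallel>a\<parallel> * \<parallel>b \<ominus> d\<parallel> + \<parallel>a \<ominus> c\<parallel> * \<parallel>d\<parallel>"
    using assms by (intro add_mono cnorm_mult) auto
  finally show ?thesis .
qed

lemma converges_to_mult:
  assumes f: "\<And>n. f n \<in> carrier A" "\<And>n. \<parallel>f n\<parallel> \<le> C" and l: "l \<in> carrier A" "converges_to f l"
    and g: "\<And>n. g n \<in> carrier A" and k: "k \<in> carrier A" "converges_to g k"
  shows "converges_to (\<lambda>n. f n \<otimes> g n) (l \<otimes> k)"
proof (rule converges_to_bound)
  show "\<parallel>f n \<otimes> g n \<ominus> l \<otimes> k\<parallel> \<le> C * \<parallel>g n \<ominus> k\<parallel> + \<parallel>f n \<ominus> l\<parallel> * \<parallel>k\<parallel>" for n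
    using norm_mult_minus_mult[of "f n" "g n" l k] mult_right_mono[OF f(2), of "\<parallel>g n \<ominus> k\<parallel>" n]
      cnorm_nonneg[of "g n \<ominus> k"] f g l k by fastforce
  have "(\<lambda>n. C * \<parallel>g n \<ominus> k\<parallel> + \<parallel>f n \<ominus> l\<parallel> * \<parallel>k\<parallel>) \<longlonglongrightarrow> C * 0 + 0 * \<parallel>k\<parallel>"
    using l k unfolding converges_to_def by (intro tendsto_intros)
  then show "(\<lambda>n. C * \<parallel>g n \<ominus> k\<parallel> + \<parallel>f n \<ominus> l\<parallel> * \<parallel>k\<parallel>) \<longlonglongrightarrow> 0" by simp
qed (use f g l k in auto)

lemma converges_to_const: "l \<in> carrier A \<Longrightarrow> converges_to (\<lambda>_. l) l"
  unfolding converges_to_def by (simp add: a_minus_def r_neg)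

lemma converges_to_adj:
  assumes "\<And>n. f n \<in> carrier A" "l \<in> carrier A" "converges_to f l"
  shows "converges_to (\<lambda>n. (f n)\<^sup>\<star>) (l\<^sup>\<star>)"
  using assms unfolding converges_to_def by (simp flip: adj_minus)

text \<open>Completeness in the form that suits a contraction: one bound on all later terms at once, so
  that no geometric series has to be summed.\<close>

lemma Cauchy_converges:
  assumes f: "\<And>n. f n \<in> carrier A" and g: "g \<longlonglongrightarrow> 0"
    and le: "\<And>n k. \<parallel>f (n + k) \<ominus> f n\<parallel> \<le> g n"
  obtains l where "l \<in> carrier A" "converges_to f l"
proof -
  have "\<exists>N. \<forall>m\<ge>N. \<forall>n\<ge>N. \<parallel>f m \<ominus> f n\<parallel> < e" if e: "0 < e" for e
  proof -
    obtain N where N: "\<And>n. n \<ge> N \<Longrightarrow> \<bar>g n\<bar> < e"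
      using LIMSEQ_D[OF g e] by auto
    have *: "\<parallel>f m \<ominus> f n\<parallel> < e" if "N \<le> n" "n \<le> m" for m n
      using le[of n "m - n"] N[of n] that by auto
    have "\<parallel>f m \<ominus> f n\<parallel> < e" if "N \<le> n" "N \<le> m" for m n
      using *[of m n] *[of n m] norm_minus_commute[OF f f, of m n] that
      by (cases "n \<le> m") auto
    then show ?thesis by blast
  qed
  then show ?thesis
    using complete[of f] f that unfolding converges_to_def by blast
qed

section \<open>Automatic continuity of *-homomorphisms\<close>

text \<open>The square root \<open>k = 1 - l\<close> of \<open>1 - h\<^sup>2\<close> comes from a fixed point \<open>l\<close> of
  \<open>F y = (h\<^sup>2 + y\<^sup>2) / 2\<close>. With \<open>r = \<parallel>h\<^sup>2\<parallel> < 1\<close>, the map \<open>F\<close> preserves the ball of radius \<open>r\<close> and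
  contracts it by the factor \<open>r\<close>, so its iterates from zero converge. They are self-adjoint
  and commute with \<open>h\<close>, and both properties pass to the limit.\<close>

lemma sqrt_one_minus_square:
  assumes h: "h \<in> carrier A" "h\<^sup>\<star> = h" "\<parallel>h\<parallel> < 1"
  obtains k where "k \<in> carrier A" "k\<^sup>\<star> = k" "h \<otimes> k = k \<otimes> h" "h \<otimes> h \<oplus> k \<otimes> k = \<one>"
proof -
  define r where "r = \<parallel>h \<otimes> h\<parallel>"
  define F where "F y = (1/2) \<odot> (h \<otimes> h \<oplus> y \<otimes> y)" for y
  define y where "y n = (F ^^ n) \<zero>" for n :: nat
  have r0: "0 \<le> r" using h by (simp add: r_def cnorm_nonneg)
  have "r \<le> \<parallel>h\<parallel> * \<parallel>h\<parallel>" using h by (simp add: r_def cnorm_mult)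
  also have "\<dots> < 1" using h cnorm_nonneg[of h] mult_strict_mono'[of "\<parallel>h\<parallel>" 1 "\<parallel>h\<parallel>" 1] by simp
  finally have r1: "r < 1" .
  have y_Suc: "y (Suc n) = F (y n)" for n by (simp add: y_def)
  have F_closed: "z \<in> carrier A \<Longrightarrow> F z \<in> carrier A" for z using h by (simp add: F_def)
  have yc [simp]: "y n \<in> carrier A" for n
    by (induction n) (simp_all add: y_Suc F_closed, simp add: y_def)
  have yr: "\<parallel>y n\<parallel> \<le> r" for n
  proof (induction n)
    case 0
    then show ?case using r0 by (simp add: y_def)
  next
    case (Suc n)
    have "\<parallel>y n \<otimes> y n\<parallel> \<le> \<parallel>y n\<parallel> * \<parallel>y n\<parallel>" by (simp add: cnorm_mult)
    also have "\<dots> \<le> r * 1"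
      using Suc r0 r1 cnorm_nonneg[OF yc] by (intro mult_mono) auto
    finally have "\<parallel>h \<otimes> h \<oplus> y n \<otimes> y n\<parallel> \<le> r + r"
      using cnorm_triangle[of "h \<otimes> h" "y n \<otimes> y n"] h by (simp add: r_def)
    then show ?case using h by (simp add: y_Suc F_def cnorm_smult)
  qed
  have F_diff: "\<parallel>F a \<ominus> F b\<parallel> = \<parallel>a \<otimes> a \<ominus> b \<otimes> b\<parallel> / 2"
    if "a \<in> carrier A" "b \<in> carrier A" for a b
  proof -
    have "F a \<ominus> F b = (1/2) \<odot> ((h \<otimes> h \<oplus> a \<otimes> a) \<ominus> (h \<otimes> h \<oplus> b \<otimes> b))"
      using that h by (simp add: F_def smult_minus_right)
    also have "(h \<otimes> h \<oplus> a \<otimes> a) \<ominus> (h \<otimes> h \<oplus> b \<otimes> b) = a \<otimes> a \<ominus> b \<otimes> b"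
      using that h by algebra
    finally show ?thesis
      using that by (simp add: cnorm_smult)
  qed
  have contr: "\<parallel>F a \<ominus> F b\<parallel> \<le> r * \<parallel>a \<ominus> b\<parallel>"
    if "a \<in> carrier A" "b \<in> carrier A" "\<parallel>a\<parallel> \<le> r" "\<parallel>b\<parallel> \<le> r" for a b
  proof -
    have "\<parallel>a \<otimes> a \<ominus> b \<otimes> b\<parallel> \<le> \<parallel>a\<parallel> * \<parallel>a \<ominus> b\<parallel> + \<parallel>a \<ominus> b\<parallel> * \<parallel>b\<parallel>"
      using that by (intro norm_mult_minus_mult)
    moreover have "\<parallel>a\<parallel> * \<parallel>a \<ominus> b\<parallel> \<le> r * \<parallel>a \<ominus> b\<parallel>" "\<parallel>a \<ominus> b\<parallel> * \<parallel>b\<parallel> \<le> \<parallel>a \<ominus> b\<parallel> * r"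
      using that by (intro mult_right_mono mult_left_mono cnorm_nonneg; simp)+
    ultimately show ?thesis using that by (simp add: F_diff mult.commute)
  qed
  have diff: "\<parallel>y (n + k) \<ominus> y n\<parallel> \<le> r ^ n" for n k
  proof (induction n)
    case 0
    have "y k \<ominus> \<zero> = y k" using yc[of k] by algebra
    then show ?case using yr[of k] r1 by (simp add: y_def)
  next
    case (Suc n)
    have "\<parallel>y (Suc n + k) \<ominus> y (Suc n)\<parallel> \<le> r * \<parallel>y (n + k) \<ominus> y n\<parallel>"
      using contr[of "y (n + k)" "y n"] yr by (simp add: y_Suc)
    also have "\<dots> \<le> r * r ^ n"
      using Suc r0 by (intro mult_left_mono)
    finally show ?case by simp
  qed
  obtain l where l: "l \<in> carrier A" "converges_to y l"
    using Cauchy_converges[of y "\<lambda>n. r ^ n"] diff LIMSEQ_realpow_zero[OF r0 r1] yc by metis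
  have "converges_to (\<lambda>n. y n \<otimes> y n) (l \<otimes> l)"
    using l yr by (intro converges_to_mult) auto
  then have "(\<lambda>n. \<parallel>y n \<otimes> y n \<ominus> l \<otimes> l\<parallel> / 2) \<longlonglongrightarrow> 0 / 2"
    unfolding converges_to_def by (intro tendsto_intros) auto
  then have "converges_to (\<lambda>n. y (Suc n)) (F l)"
    using l by (simp add: converges_to_def y_Suc F_diff)
  then have fixp: "F l = l"
    using l converges_to_Suc[OF l(2)] F_closed
    by (intro converges_to_unique[of "\<lambda>n. y (Suc n)"]) auto
  have comm: "h \<otimes> y n = y n \<otimes> h" for n
  proof (induction n)
    case 0
    then show ?case using h by (simp add: y_def)
  next
    case (Suc n)
    have "h \<otimes> (y n \<otimes> y n) = (y n \<otimes> y n) \<otimes> h"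
      using Suc h by (metis m_assoc yc)
    then have "h \<otimes> (h \<otimes> h \<oplus> y n \<otimes> y n) = (h \<otimes> h \<oplus> y n \<otimes> y n) \<otimes> h"
      using h by (simp add: l_distr r_distr m_assoc)
    then show ?case using h by (simp add: y_Suc F_def smult_mult_left smult_mult_right)
  qed
  have lcomm: "h \<otimes> l = l \<otimes> h"
  proof (rule converges_to_unique)
    show "converges_to (\<lambda>n. h \<otimes> y n) (h \<otimes> l)"
      using h l by (intro converges_to_mult[of _ "\<parallel>h\<parallel>"] converges_to_const) auto
    show "converges_to (\<lambda>n. h \<otimes> y n) (l \<otimes> h)"
      unfolding comm using h l yr by (intro converges_to_mult converges_to_const) auto
  qed (use h l in auto)
  have ysa: "(y n)\<^sup>\<star> = y n" for n
    by (induction n) (simp_all add: y_Suc F_def h adj_smult adj_add adj_mult, simp add: y_def)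
  have lsa: "l\<^sup>\<star> = l"
  proof (rule converges_to_unique)
    show "converges_to y (l\<^sup>\<star>)"
      using converges_to_adj[of y l] l by (simp add: ysa)
  qed (use l in auto)
  show ?thesis
  proof (rule that[of "\<one> \<ominus> l"])
    show "(\<one> \<ominus> l)\<^sup>\<star> = \<one> \<ominus> l" using l lsa by (simp add: adj_minus)
    show "h \<otimes> (\<one> \<ominus> l) = (\<one> \<ominus> l) \<otimes> h"
      using h l lcomm by (simp add: minus_eq l_distr r_distr l_minus r_minus)
    have "2 \<odot> l = 2 \<odot> F l" by (simp add: fixp)
    also have "\<dots> = h \<otimes> h \<oplus> l \<otimes> l" using h l by (simp add: F_def smult_smult)
    finally have "l \<oplus> l = h \<otimes> h \<oplus> l \<otimes> l"
      using smult_add_left[of l 1 1] l by simp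
    then have "h \<otimes> h = l \<oplus> l \<ominus> l \<otimes> l"
      using h l by algebra
    then have "h \<otimes> h \<oplus> (\<one> \<ominus> l) \<otimes> (\<one> \<ominus> l) = l \<oplus> l \<ominus> l \<otimes> l \<oplus> (\<one> \<ominus> l) \<otimes> (\<one> \<ominus> l)"
      by simp
    also have "\<dots> = \<one>" using l by algebra (simp add: r_neg)
    finally show "h \<otimes> h \<oplus> (\<one> \<ominus> l) \<otimes> (\<one> \<ominus> l) = \<one>" .
  qed (use l in auto)
qed

text \<open>The unitary is \<open>h + \<i>\<surd>(1 - h\<^sup>2)\<close>.\<close>

lemma unitary_with_real_part:
  assumes h: "h \<in> carrier A" "h\<^sup>\<star> = h" "\<parallel>h\<parallel> < 1"
  obtains u where "u \<in> carrier A" "u\<^sup>\<star> \<otimes> u = \<one>" "h = (1/2) \<odot> (u \<oplus> u\<^sup>\<star>)"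
proof -
  obtain k where k: "k \<in> carrier A" "k\<^sup>\<star> = k" "h \<otimes> k = k \<otimes> h" "h \<otimes> h \<oplus> k \<otimes> k = \<one>"
    using sqrt_one_minus_square[OF h] .
  define u where "u = h \<oplus> \<i> \<odot> k"
  have uc: "u \<in> carrier A" using h k by (simp add: u_def)
  have ua: "u\<^sup>\<star> = h \<oplus> (-\<i>) \<odot> k" using h k by (simp add: u_def adj_add adj_smult)
  have "u\<^sup>\<star> \<otimes> u = (h \<otimes> h \<oplus> (-\<i>) \<odot> (k \<otimes> h)) \<oplus> (\<i> \<odot> (k \<otimes> h) \<oplus> k \<otimes> k)"
    unfolding ua using h k
    by (simp add: u_def l_distr r_distr smult_mult_left smult_mult_right smult_smult smult_add_right)
  also have "\<dots> = (h \<otimes> h \<oplus> k \<otimes> k) \<oplus> (\<i> \<odot> (k \<otimes> h) \<oplus> (-\<i>) \<odot> (k \<otimes> h))"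
    using h(1) k(1) by (simp add: a_ac)
  also have "\<i> \<odot> (k \<otimes> h) \<oplus> (-\<i>) \<odot> (k \<otimes> h) = \<zero>"
    using h k by (simp flip: smult_add_left)
  finally have uu: "u\<^sup>\<star> \<otimes> u = \<one>" using k by simp
  have "u \<oplus> u\<^sup>\<star> = (h \<oplus> h) \<oplus> (\<i> \<odot> k \<oplus> (-\<i>) \<odot> k)"
    unfolding ua using h k by (simp add: u_def a_ac)
  also have "\<i> \<odot> k \<oplus> (-\<i>) \<odot> k = \<zero>"
    using k by (simp flip: smult_add_left)
  also have "h \<oplus> h = 2 \<odot> h" using smult_add_left[of h 1 1] h by simp
  finally have "(1/2) \<odot> (u \<oplus> u\<^sup>\<star>) = h" using h by (simp add: smult_smult)
  then show ?thesis using that uc uu by metis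
qed

end

lemma star_homD:
  assumes "\<pi> \<in> star_hom A B"
  shows "\<pi> \<in> ring_hom A B"
    and "x \<in> carrier A \<Longrightarrow> \<pi> x \<in> carrier B"
    and "\<lbrakk>x \<in> carrier A; y \<in> carrier A\<rbrakk> \<Longrightarrow> \<pi> (x \<otimes>\<^bsub>A\<^esub> y) = \<pi> x \<otimes>\<^bsub>B\<^esub> \<pi> y"
    and "\<lbrakk>x \<in> carrier A; y \<in> carrier A\<rbrakk> \<Longrightarrow> \<pi> (x \<oplus>\<^bsub>A\<^esub> y) = \<pi> x \<oplus>\<^bsub>B\<^esub> \<pi> y"
    and "\<pi> \<one>\<^bsub>A\<^esub> = \<one>\<^bsub>B\<^esub>"
    and "x \<in> carrier A \<Longrightarrow> \<pi> (x\<^sup>\<star>\<^bsub>A\<^esub>) = (\<pi> x)\<^sup>\<star>\<^bsub>B\<^esub>"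
    and "x \<in> carrier A \<Longrightarrow> \<pi> (c \<odot>\<^bsub>A\<^esub> x) = c \<odot>\<^bsub>B\<^esub> \<pi> x"
  using assms unfolding star_hom_def by (auto simp: ring_hom_def)

lemma star_hom_comp:
  assumes "\<pi> \<in> star_hom A B" "\<rho> \<in> star_hom B C"
  shows "\<rho> \<circ> \<pi> \<in> star_hom A C"
  using assms ring_hom_trans[of \<pi> A B \<rho> C] star_homD[OF assms(1)]
  unfolding star_hom_def by auto

text \<open>By the C*-identity it is enough to treat self-adjoint elements, and by scaling those of norm
  below one. Such an element is the real part of a unitary, and the image of a unitary has norm
  at most one. No spectral theory enters.\<close>

lemma star_hom_contractive:
  assumes A: "cstar_algebra A" and B: "cstar_algebra B" and p: "\<pi> \<in> star_hom A B"
    and x: "x \<in> carrier A"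
  shows "\<parallel>\<pi> x\<parallel>\<^bsub>B\<^esub> \<le> \<parallel>x\<parallel>\<^bsub>A\<^esub>"
proof -
  interpret A: cstar_algebra A by fact
  interpret B: cstar_algebra B by fact
  note hom = star_homD[OF p]
  have unit: "\<parallel>\<pi> h\<parallel>\<^bsub>B\<^esub> \<le> 1"
    if h: "h \<in> carrier A" "h\<^sup>\<star>\<^bsub>A\<^esub> = h" "\<parallel>h\<parallel>\<^bsub>A\<^esub> < 1" for h
  proof -
    obtain u where u: "u \<in> carrier A" "u\<^sup>\<star>\<^bsub>A\<^esub> \<otimes>\<^bsub>A\<^esub> u = \<one>\<^bsub>A\<^esub>"
        "h = (1/2) \<odot>\<^bsub>A\<^esub> (u \<oplus>\<^bsub>A\<^esub> u\<^sup>\<star>\<^bsub>A\<^esub>)"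
      using A.unitary_with_real_part[OF h] .
    have "(\<pi> u)\<^sup>\<star>\<^bsub>B\<^esub> \<otimes>\<^bsub>B\<^esub> \<pi> u = \<one>\<^bsub>B\<^esub>"
      using u hom(3)[of "u\<^sup>\<star>\<^bsub>A\<^esub>" u] hom(5,6) by simp
    then have "\<parallel>\<pi> u\<parallel>\<^bsub>B\<^esub> \<le> 1"
      using u by (intro B.norm_isometry_le hom)
    moreover have "\<pi> h = (1/2) \<odot>\<^bsub>B\<^esub> (\<pi> u \<oplus>\<^bsub>B\<^esub> (\<pi> u)\<^sup>\<star>\<^bsub>B\<^esub>)"
      using u by (simp add: hom)
    moreover have "\<parallel>\<pi> u \<oplus>\<^bsub>B\<^esub> (\<pi> u)\<^sup>\<star>\<^bsub>B\<^esub>\<parallel>\<^bsub>B\<^esub> \<le> \<parallel>\<pi> u\<parallel>\<^bsub>B\<^esub> + \<parallel>\<pi> u\<parallel>\<^bsub>B\<^esub>"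
      using B.cnorm_triangle[of "\<pi> u" "(\<pi> u)\<^sup>\<star>\<^bsub>B\<^esub>"] u hom(2) by simp
    ultimately show ?thesis
      using u hom(2) by (simp add: B.cnorm_smult)
  qed
  have sa: "\<parallel>\<pi> h\<parallel>\<^bsub>B\<^esub> \<le> \<parallel>h\<parallel>\<^bsub>A\<^esub>" if h: "h \<in> carrier A" "h\<^sup>\<star>\<^bsub>A\<^esub> = h" for h
  proof (rule field_le_epsilon)
    fix e :: real assume e: "0 < e"
    define r where "r = \<parallel>h\<parallel>\<^bsub>A\<^esub> + e"
    have r: "\<parallel>h\<parallel>\<^bsub>A\<^esub> < r" "0 < r"
      using e A.cnorm_nonneg[OF h(1)] by (auto simp: r_def)
    have "\<parallel>\<pi> (complex_of_real (1/r) \<odot>\<^bsub>A\<^esub> h)\<parallel>\<^bsub>B\<^esub> \<le> 1"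
      using h r by (intro unit) (auto simp: A.adj_smult A.cnorm_smult norm_divide simp del: of_real_divide)
    then show "\<parallel>\<pi> h\<parallel>\<^bsub>B\<^esub> \<le> \<parallel>h\<parallel>\<^bsub>A\<^esub> + e"
      using h r hom by (simp add: B.cnorm_smult norm_divide r_def[symmetric])
  qed
  have "(\<parallel>\<pi> x\<parallel>\<^bsub>B\<^esub>)\<^sup>2 = \<parallel>\<pi> (x\<^sup>\<star>\<^bsub>A\<^esub> \<otimes>\<^bsub>A\<^esub> x)\<parallel>\<^bsub>B\<^esub>"
    using x hom by (simp add: B.cstar_identity)
  also have "\<dots> \<le> (\<parallel>x\<parallel>\<^bsub>A\<^esub>)\<^sup>2"
    using sa[of "x\<^sup>\<star>\<^bsub>A\<^esub> \<otimes>\<^bsub>A\<^esub> x"] x by (simp add: A.adj_mult A.cstar_identity)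
  finally show ?thesis
    using A.cnorm_nonneg[OF x] by (rule power2_le_imp_le)
qed

text \<open>The equalizer of two *-homomorphisms is a *-subalgebra, and it is closed because both are
  contractive.\<close>

lemma star_hom_eq_on_generated:
  assumes A: "cstar_algebra A" and B: "cstar_algebra B"
    and p: "\<pi> \<in> star_hom A B" and r: "\<rho> \<in> star_hom A B"
    and G: "G \<subseteq> carrier A" "\<And>g. g \<in> G \<Longrightarrow> \<pi> g = \<rho> g" and x: "x \<in> cstar_generated A G"
  shows "\<pi> x = \<rho> x"
proof -
  interpret A: cstar_algebra A by fact
  interpret B: cstar_algebra B by fact
  note homs = star_homD[OF p] star_homD[OF r]
  define E where "E = {x \<in> carrier A. \<pi> x = \<rho> x}"
  have lim: "B.converges_to (\<lambda>n. \<sigma> (f n)) (\<sigma> l)"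
    if "\<sigma> \<in> star_hom A B" "\<And>n. f n \<in> carrier A" "l \<in> carrier A"
      "(\<lambda>n. \<parallel>f n \<ominus>\<^bsub>A\<^esub> l\<parallel>\<^bsub>A\<^esub>) \<longlonglongrightarrow> 0" for \<sigma> f l
  proof (rule B.converges_to_bound[OF _ that(4)])
    note h = star_homD[OF that(1)]
    have "\<sigma> (f n \<ominus>\<^bsub>A\<^esub> l) = \<sigma> (f n) \<ominus>\<^bsub>B\<^esub> \<sigma> l" for n
      using that(2,3) h by (simp add: A.minus_eq B.minus_eq flip: A.smult_minus_one B.smult_minus_one)
    then show "\<parallel>\<sigma> (f n) \<ominus>\<^bsub>B\<^esub> \<sigma> l\<parallel>\<^bsub>B\<^esub> \<le> \<parallel>f n \<ominus>\<^bsub>A\<^esub> l\<parallel>\<^bsub>A\<^esub>" for n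
      using star_hom_contractive[OF A B that(1), of "f n \<ominus>\<^bsub>A\<^esub> l"] that(2,3) by simp
  qed (use that star_homD(2)[OF that(1)] in auto)
  have "\<zero>\<^bsub>A\<^esub> \<in> E"
    using homs(7)[of "\<zero>\<^bsub>A\<^esub>" 0] homs(14)[of "\<zero>\<^bsub>A\<^esub>" 0] homs(2,9) by (simp add: E_def)
  moreover have "l \<in> E"
    if "l \<in> carrier A" "\<And>n. f n \<in> E" "(\<lambda>n. \<parallel>f n \<ominus>\<^bsub>A\<^esub> l\<parallel>\<^bsub>A\<^esub>) \<longlonglongrightarrow> 0" for f l
    using lim[OF p, of f l] lim[OF r, of f l] that
      B.converges_to_unique[of "\<lambda>n. \<pi> (f n)" "\<pi> l" "\<rho> l"] homs(2,9)
    by (simp add: E_def)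
  ultimately have "cstar_subalgebra A E"
    unfolding cstar_subalgebra_def
    by (simp add: E_def homs) blast
  then have "cstar_generated A G \<subseteq> E"
    unfolding cstar_generated_def using G by (intro hull_minimal) (auto simp: E_def)
  then show ?thesis
    using x by (auto simp: E_def)
qed

section \<open>Isometries and unitaries\<close>

context cstar_algebra
begin

lemma isometryD:
  assumes "isometry_in A x"
  shows "x \<in> carrier A" "x\<^sup>\<star> \<otimes> x = \<one>"
  using assms by (auto simp: isometry_in_def)

lemma cancel_left:
  "\<lbrakk>x \<otimes> y = \<one>; x \<in> carrier A; y \<in> carrier A; z \<in> carrier A\<rbrakk> \<Longrightarrow> x \<otimes> (y \<otimes> z) = z"
  by (simp flip: m_assoc)

lemma isometry_mult:
  assumes "isometry_in A x" "isometry_in A y"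
  shows "isometry_in A (x \<otimes> y)"
  using isometryD[OF assms(1)] isometryD[OF assms(2)]
  by (simp add: isometry_in_def adj_mult m_assoc cancel_left[of "x\<^sup>\<star>" x])

lemma isometry_one: "isometry_in A \<one>"
  by (simp add: isometry_in_def)

lemma isometry_pow: "isometry_in A x \<Longrightarrow> isometry_in A (x [^] (n::nat))"
  by (induction n) (simp_all add: isometry_one isometry_mult)

lemma adj_pow: "x \<in> carrier A \<Longrightarrow> (x [^] (n::nat))\<^sup>\<star> = (x\<^sup>\<star>) [^] n"
  by (induction n) (simp_all add: adj_mult flip: nat_pow_Suc2)

lemma pow_adj_pow:
  assumes "isometry_in A x" "k \<le> n"
  shows "(x\<^sup>\<star>) [^] (k::nat) \<otimes> x [^] n = x [^] (n - k)"
proof -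
  have "x [^] n = x [^] k \<otimes> x [^] (n - k)"
    using assms isometryD by (simp add: nat_pow_mult)
  then show ?thesis
    using isometryD[OF isometry_pow[OF assms(1), of k]] isometryD[OF assms(1)]
    by (simp add: adj_pow cancel_left)
qed

lemma intertwine_pow:
  assumes "x \<in> carrier A" "y \<in> carrier A" "w \<in> carrier A" "w \<otimes> x = y [^] (p::nat) \<otimes> w"
  shows "w \<otimes> x [^] (n::nat) = y [^] (p * n) \<otimes> w"
proof (induction n)
  case 0
  then show ?case using assms by simp
next
  case (Suc n)
  have "w \<otimes> x [^] Suc n = (w \<otimes> x [^] n) \<otimes> x"
    using assms(1-3) by (simp add: m_assoc)
  also have "\<dots> = y [^] (p * n) \<otimes> (w \<otimes> x)"
    using assms(1-3) by (simp add: Suc m_assoc)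
  also have "\<dots> = y [^] (p * n + p) \<otimes> w"
    using assms by (simp add: nat_pow_mult flip: m_assoc)
  finally show ?case by (simp add: add.commute)
qed

text \<open>For a unitary \<open>x\<close>, an intertwining relation for \<open>x\<close> passes to its inverse \<open>x\<^sup>\<star>\<close>.\<close>

lemma intertwine_adj:
  assumes x: "isometry_in A x" "x \<otimes> x\<^sup>\<star> = \<one>" and w: "w \<in> carrier A"
    and "w \<otimes> x = x [^] (p::nat) \<otimes> w"
  shows "w \<otimes> x\<^sup>\<star> = (x\<^sup>\<star>) [^] p \<otimes> w"
proof -
  note [simp] = isometryD[OF x(1)]
  have "w \<otimes> x\<^sup>\<star> = (x\<^sup>\<star>) [^] p \<otimes> (x [^] p \<otimes> w) \<otimes> x\<^sup>\<star>"
    using pow_adj_pow[OF x(1), of p p] w by (simp flip: m_assoc)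
  also have "\<dots> = (x\<^sup>\<star>) [^] p \<otimes> w \<otimes> (x \<otimes> x\<^sup>\<star>)"
    using w by (simp add: m_assoc flip: assms(4))
  finally show ?thesis using w x by simp
qed

text \<open>The collapse on which everything rests: an isometry \<open>t\<close> with \<open>t\<^sup>2 = s\<^sup>3\<close> whose adjoint
  commutes with \<open>s\<close> satisfies \<open>t = t\<^sup>\<star>t\<^sup>2 = s\<^sup>3t\<^sup>\<star> = t(tt\<^sup>\<star>)\<close>. Then \<open>s\<close> has the right inverse
  \<open>s\<^sup>2(t\<^sup>2)\<^sup>\<star>\<close>, and an isometry with a right inverse is unitary.\<close>

lemma unitary_from_cube_relation:
  assumes s: "isometry_in A s" and t: "isometry_in A t"
    and st: "t [^] (2::nat) = s [^] (3::nat)" "t\<^sup>\<star> \<otimes> s = s \<otimes> t\<^sup>\<star>"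
  shows "t \<otimes> t\<^sup>\<star> = \<one>" "s \<otimes> s\<^sup>\<star> = \<one>"
proof -
  note [simp] = isometryD[OF s] isometryD[OF t]
  have tt: "t \<otimes> t = s \<otimes> (s \<otimes> s)"
    using st(1) by (simp add: numeral_2_eq_2 numeral_3_eq_3 m_assoc)
  have comm: "t\<^sup>\<star> \<otimes> (s \<otimes> z) = s \<otimes> (t\<^sup>\<star> \<otimes> z)" if "z \<in> carrier A" for z
    using that st(2) by (simp flip: m_assoc)
  have "t = t\<^sup>\<star> \<otimes> (t \<otimes> t)"
    by (simp add: cancel_left)
  also have "\<dots> = s \<otimes> (s \<otimes> s) \<otimes> t\<^sup>\<star>"
    unfolding tt by (simp add: comm st(2) m_assoc)
  also have "\<dots> = t \<otimes> (t \<otimes> t\<^sup>\<star>)"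
    by (simp add: m_assoc flip: tt)
  finally have "t\<^sup>\<star> \<otimes> t = t\<^sup>\<star> \<otimes> (t \<otimes> (t \<otimes> t\<^sup>\<star>))" by simp
  then show t1: "t \<otimes> t\<^sup>\<star> = \<one>"
    by (simp add: cancel_left)
  define r where "r = s \<otimes> s \<otimes> (t \<otimes> t)\<^sup>\<star>"
  have rc: "r \<in> carrier A" by (simp add: r_def)
  have "s \<otimes> r = (t \<otimes> t) \<otimes> (t \<otimes> t)\<^sup>\<star>"
    by (simp add: r_def tt m_assoc)
  also have "\<dots> = \<one>"
    by (simp add: adj_mult m_assoc t1 cancel_left[OF t1])
  finally have sr: "s \<otimes> r = \<one>" .
  have "s\<^sup>\<star> = s\<^sup>\<star> \<otimes> (s \<otimes> r)" by (simp add: sr)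
  also have "\<dots> = r" using rc by (simp add: cancel_left)
  finally show "s \<otimes> s\<^sup>\<star> = \<one>" using sr by simp
qed

end

section \<open>The presentation yields a covariant representation\<close>

lemma pos_nat_prime_induct [consumes 1, case_names one prime_mult]:
  fixes n :: nat
  assumes "0 < n" "P 1" "\<And>p n. \<lbrakk>prime p; 0 < n; P n\<rbrakk> \<Longrightarrow> P (p * n)"
  shows "P n"
  using assms(1)
proof (induction n rule: prime_divisors_induct)
  case (factor p x)
  then show ?case using assms(3)[of p x] by simp
qed (use assms in auto)

lemma gcd_lcm_factors:
  assumes "0 < (a::nat)" "0 < b"
  obtains a' b' where "a = gcd a b * a'" "b = gcd a b * b'" "coprime a' b'"
    "a * b' = lcm a b" "b * a' = lcm a b" "0 < a'" "0 < b'" "0 < gcd a b"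
proof -
  obtain a' b' where ab: "a = gcd a b * a'" "b = gcd a b * b'" "coprime a' b'"
    using gcd_coprime_exists[of a b] assms by (auto simp: mult.commute)
  have g: "gcd a b \<noteq> 0" using assms by simp
  have "gcd a b * (a * b') = gcd a b * lcm a b" "gcd a b * (b * a') = gcd a b * lcm a b"
    unfolding prod_gcd_lcm_nat[of a b, symmetric]
    using ab(1,2)[symmetric] by (simp_all add: mult.left_commute[of "gcd a b"])
  then have "a * b' = lcm a b" "b * a' = lcm a b"
    unfolding mult_left_cancel[OF g] .
  moreover have "a' \<noteq> 0" "b' \<noteq> 0"
    using ab(1,2) assms by (metis mult_0_right not_less_zero)+
  ultimately show ?thesis
    using that[OF ab] g by simp
qed

locale cstar_presentation = cstar_algebra A + presentation_relations A s t v
  for A :: "'a cstar" (structure) and s t :: 'a and v :: "nat \<Rightarrow> 'a"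
begin

text \<open>The missing translation by \<open>1 = 3 - 2\<close>.\<close>

definition u :: 'a where "u = t \<otimes> s\<^sup>\<star>"

lemma closed [simp, intro]: "s \<in> carrier A" "t \<in> carrier A" "u \<in> carrier A"
    "prime p \<Longrightarrow> v p \<in> carrier A"
  using isometry_s isometry_t isometry_v by (auto simp: isometry_in_def u_def)

lemmas s_adj_s [simp] = isometryD(2)[OF isometry_s]
lemmas t_adj_t [simp] = isometryD(2)[OF isometry_t]
lemmas v_adj_v [simp] = isometryD(2)[OF isometry_v]

lemmas t_t_adj [simp] = unitary_from_cube_relation(1)[OF isometry_s isometry_t R1 R2(3)]
lemmas s_s_adj [simp] = unitary_from_cube_relation(2)[OF isometry_s isometry_t R1 R2(3)]

lemma u_adj_u [simp]: "u\<^sup>\<star> \<otimes> u = \<one>"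
  by (simp add: u_def adj_mult m_assoc cancel_left[OF t_adj_t])

lemma u_u_adj [simp]: "u \<otimes> u\<^sup>\<star> = \<one>"
  by (simp add: u_def adj_mult m_assoc cancel_left[OF s_adj_s])

lemma isometry_u: "isometry_in A u"
  by (simp add: isometry_in_def)

lemma u_square: "u [^] (2::nat) = s"
proof -
  have "u [^] (2::nat) = t \<otimes> (s\<^sup>\<star> \<otimes> t) \<otimes> s\<^sup>\<star>"
    by (simp add: numeral_2_eq_2 u_def m_assoc)
  also have "\<dots> = t [^] (2::nat) \<otimes> (s\<^sup>\<star> \<otimes> s\<^sup>\<star>)"
    unfolding R2 by (simp add: numeral_2_eq_2 m_assoc)
  also have "\<dots> = s"
    unfolding R1 by (simp add: numeral_3_eq_3 m_assoc cancel_left[OF s_s_adj])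
  finally show ?thesis .
qed

lemma u_cube: "u [^] (3::nat) = t"
proof -
  have "u [^] (3::nat) = u [^] (2::nat) \<otimes> u"
    by (simp add: numeral_3_eq_3 numeral_2_eq_2)
  also have "\<dots> = t \<otimes> s \<otimes> s\<^sup>\<star>"
    unfolding u_square R2(1) by (simp add: u_def R2(1) flip: m_assoc)
  finally show ?thesis by (simp add: m_assoc)
qed

lemma u_pow: "u [^] (k::nat) = t [^] k \<otimes> (s\<^sup>\<star>) [^] k"
  unfolding u_def using R2(2) by (intro pow_mult_distrib) auto

lemma v_u: assumes p: "prime p" shows "v p \<otimes> u = u [^] p \<otimes> v p"
proof -
  have "v p \<otimes> u = t [^] p \<otimes> (v p \<otimes> s\<^sup>\<star>)"
    using p by (simp add: u_def T1(2) flip: m_assoc)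
  then show ?thesis
    using p by (simp add: T1(3) u_pow m_assoc)
qed

lemma v_u_pow: "prime p \<Longrightarrow> v p \<otimes> u [^] (k::nat) = u [^] (p * k) \<otimes> v p"
  by (intro intertwine_pow v_u) auto

lemma v_compress_dvd:
  assumes p: "prime p" shows "(v p)\<^sup>\<star> \<otimes> (u [^] (p * k) \<otimes> v p) = u [^] k"
  using p by (simp add: cancel_left flip: v_u_pow)

text \<open>Multiples of \<open>p\<close> in the exponent can be moved across \<open>v p\<close>, which leaves a remainder below
  \<open>p\<close>. For that remainder the relation for \<open>v\<^sub>p\<^sup>\<star> t\<^sup>k s\<^sup>\<star>\<^sup>k v\<^sub>p\<close> applies, because
  \<open>u\<^sup>k = t\<^sup>k s\<^sup>\<star>\<^sup>k\<close>.\<close>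

lemma v_compress_not_dvd:
  assumes p: "prime p" and k: "\<not> p dvd k" shows "(v p)\<^sup>\<star> \<otimes> (u [^] k \<otimes> v p) = \<zero>"
proof -
  have r: "1 \<le> k mod p" "k mod p < p"
    using k p by (auto simp: dvd_eq_mod_eq_0 prime_gt_0_nat Suc_le_eq)
  have "u [^] k = u [^] (k mod p) \<otimes> u [^] (p * (k div p))"
    by (simp add: nat_pow_mult)
  then have "(v p)\<^sup>\<star> \<otimes> (u [^] k \<otimes> v p)
      = (v p)\<^sup>\<star> \<otimes> (t [^] (k mod p) \<otimes> (s\<^sup>\<star>) [^] (k mod p)) \<otimes> (u [^] (p * (k div p)) \<otimes> v p)"
    using p by (simp add: m_assoc u_pow[of "k mod p"])
  also have "\<dots> = ((v p)\<^sup>\<star> \<otimes> t [^] (k mod p) \<otimes> (s\<^sup>\<star>) [^] (k mod p) \<otimes> v p) \<otimes> u [^] (k div p)"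
    using p by (simp add: m_assoc flip: v_u_pow)
  also have "\<dots> = \<zero>"
    using T6(6)[OF p r] by simp
  finally show ?thesis .
qed

text \<open>The product of \<open>v p\<close> over the prime factors of \<open>a\<close>, with multiplicity. The guards make the
  folded function commute with itself at all arguments, not only at primes and elements of the
  carrier, so that the order of the factors does not matter.\<close>

definition V :: "nat \<Rightarrow> 'a" where
  "V a = fold_mset (\<lambda>p x. if prime p \<and> x \<in> carrier A then v p \<otimes> x else x) \<one>
           (prime_factorization a)"

lemma V_1 [simp]: "V 1 = \<one>" "V (Suc 0) = \<one>"
  by (simp_all add: V_def)

lemma V_prime_mult_aux:
  assumes "prime p" "0 < a"
  shows "V (p * a) = (if V a \<in> carrier A then v p \<otimes> V a else V a)"
proof -
  let ?f = "\<lambda>p x. if prime p \<and> x \<in> carrier A then v p \<otimes> x else x"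
  have "?f q (?f p x) = ?f p (?f q x)" for p q x
    using T2[of p q] by (auto simp flip: m_assoc)
  then interpret comp_fun_commute ?f
    by unfold_locales (auto simp: fun_eq_iff)
  show ?thesis
    using assms by (simp add: V_def prime_factorization_mult prime_factorization_prime)
qed

lemma V_closed [simp, intro]: assumes "0 < a" shows "V a \<in> carrier A"
  using assms by (induction a rule: pos_nat_prime_induct) (simp_all add: V_prime_mult_aux)

lemma V_prime_mult: "\<lbrakk>prime p; 0 < a\<rbrakk> \<Longrightarrow> V (p * a) = v p \<otimes> V a"
  by (simp add: V_prime_mult_aux)

lemma V_prime: "prime p \<Longrightarrow> V p = v p"
  using V_prime_mult[of p 1] by simp

lemma V_mult: assumes "0 < a" "0 < b" shows "V (a * b) = V a \<otimes> V b"
  using assms(1)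
proof (induction a rule: pos_nat_prime_induct)
  case (prime_mult p a)
  then show ?case
    using assms(2) V_prime_mult[of p "a * b"] by (simp add: V_prime_mult m_assoc mult.assoc)
qed (use assms in simp)

lemma isometry_V: assumes "0 < a" shows "isometry_in A (V a)"
  using assms
  by (induction a rule: pos_nat_prime_induct)
     (simp_all add: isometry_one V_prime_mult isometry_mult isometry_v)

lemmas V_adj_V [simp] = isometryD(2)[OF isometry_V]

lemma V_u_pow: assumes "0 < a" shows "V a \<otimes> u [^] (k::nat) = u [^] (a * k) \<otimes> V a"
  using assms
proof (induction a arbitrary: k rule: pos_nat_prime_induct)
  case (prime_mult p a)
  have "V (p * a) \<otimes> u [^] k = v p \<otimes> u [^] (a * k) \<otimes> V a"
    using prime_mult by (simp add: V_prime_mult m_assoc)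
  then show ?case
    using prime_mult by (simp add: V_prime_mult v_u_pow m_assoc mult.assoc)
qed simp

lemma v_adj_V:
  assumes "0 < b" "prime p" "\<not> p dvd b" shows "(v p)\<^sup>\<star> \<otimes> V b = V b \<otimes> (v p)\<^sup>\<star>"
  using assms
proof (induction b rule: pos_nat_prime_induct)
  case (prime_mult q b)
  then have pq: "p \<noteq> q" "\<not> p dvd b" by auto
  have "(v p)\<^sup>\<star> \<otimes> V (q * b) = (v p)\<^sup>\<star> \<otimes> v q \<otimes> V b"
    using prime_mult by (simp add: V_prime_mult m_assoc)
  also have "\<dots> = v q \<otimes> ((v p)\<^sup>\<star> \<otimes> V b)"
    using prime_mult pq by (simp add: T3 m_assoc)
  also have "\<dots> = V (q * b) \<otimes> (v p)\<^sup>\<star>"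
    using prime_mult pq by (simp add: V_prime_mult m_assoc)
  finally show ?case .
qed simp

lemma V_adj_V_coprime:
  assumes "0 < a" "0 < b" "coprime a b" shows "(V a)\<^sup>\<star> \<otimes> V b = V b \<otimes> (V a)\<^sup>\<star>"
  using assms(1,3)
proof (induction a rule: pos_nat_prime_induct)
  case (prime_mult p a)
  have ab: "coprime a b" "\<not> p dvd b"
    using prime_mult by (auto simp: prime_imp_coprime_nat coprime_commute)
  have "(V (p * a))\<^sup>\<star> \<otimes> V b = (V a)\<^sup>\<star> \<otimes> ((v p)\<^sup>\<star> \<otimes> V b)"
    using prime_mult assms by (simp add: V_prime_mult adj_mult m_assoc)
  also have "\<dots> = ((V a)\<^sup>\<star> \<otimes> V b) \<otimes> (v p)\<^sup>\<star>"
    using prime_mult.hyps ab assms by (simp add: v_adj_V m_assoc)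
  also have "\<dots> = V b \<otimes> (V a)\<^sup>\<star> \<otimes> (v p)\<^sup>\<star>"
    using prime_mult.IH ab by simp
  also have "\<dots> = V b \<otimes> (V (p * a))\<^sup>\<star>"
    using prime_mult assms by (simp add: V_prime_mult adj_mult m_assoc)
  finally show ?case .
qed (use assms in simp)

text \<open>Peel off one prime \<open>p\<close> at a time: either \<open>p\<close> does not divide \<open>k\<close> and the inner compression
  vanishes, or it turns \<open>u\<^sup>k\<close> into \<open>u\<close> to the power \<open>k div p\<close>.\<close>

lemma V_compress_not_dvd:
  assumes "0 < a" "\<not> a dvd k" shows "(V a)\<^sup>\<star> \<otimes> (u [^] k \<otimes> V a) = \<zero>"
  using assms
proof (induction a arbitrary: k rule: pos_nat_prime_induct)
  case (prime_mult p a)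
  have eq: "(V (p * a))\<^sup>\<star> \<otimes> (u [^] k \<otimes> V (p * a))
      = (V a)\<^sup>\<star> \<otimes> ((v p)\<^sup>\<star> \<otimes> (u [^] k \<otimes> v p)) \<otimes> V a"
    using prime_mult by (simp add: V_prime_mult adj_mult m_assoc)
  show ?case
  proof (cases "p dvd k")
    case True
    then obtain j where j: "k = p * j" by blast
    then have "\<not> a dvd j" using prime_mult by auto
    then show ?thesis
      unfolding eq unfolding j using prime_mult by (simp add: v_compress_dvd m_assoc)
  next
    case False
    then show ?thesis
      unfolding eq using prime_mult by (simp add: v_compress_not_dvd)
  qed
qed simp

lemma V_adj_u_V_zero:
  assumes "0 < a" "0 < b" "\<not> gcd a b dvd k" shows "(V a)\<^sup>\<star> \<otimes> (u [^] k \<otimes> V b) = \<zero>"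
proof -
  obtain a' b' where ab: "a = gcd a b * a'" "b = gcd a b * b'" "0 < a'" "0 < b'" "0 < gcd a b"
    using gcd_lcm_factors[OF assms(1,2)] by metis
  have "V a = V (gcd a b) \<otimes> V a'" "V b = V (gcd a b) \<otimes> V b'"
    using V_mult[of "gcd a b" a'] V_mult[of "gcd a b" b'] ab(1,2)[symmetric] assms ab(3,4) by simp_all
  then have "(V a)\<^sup>\<star> \<otimes> (u [^] k \<otimes> V b)
      = (V a')\<^sup>\<star> \<otimes> ((V (gcd a b))\<^sup>\<star> \<otimes> (u [^] k \<otimes> V (gcd a b))) \<otimes> V b'"
    using ab(3-5) by (simp add: adj_mult m_assoc)
  also have "\<dots> = \<zero>"
    using ab(3-5) V_compress_not_dvd[of "gcd a b" k] assms(3) by simp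
  finally show ?thesis .
qed

text \<open>Write \<open>a = ga'\<close> and \<open>b = gb'\<close> with \<open>g = gcd a b\<close>. The factor \<open>V g\<close> cancels in
  \<open>(V a)\<^sup>\<star> V b\<close>, and the remaining coprime factors commute past each other.\<close>

lemma V_range_mult:
  assumes "0 < a" "0 < b"
  shows "V a \<otimes> (V a)\<^sup>\<star> \<otimes> (V b \<otimes> (V b)\<^sup>\<star>) = V (lcm a b) \<otimes> (V (lcm a b))\<^sup>\<star>"
proof -
  obtain a' b' where ab: "a = gcd a b * a'" "b = gcd a b * b'" "coprime a' b'"
    "a * b' = lcm a b" "b * a' = lcm a b" "0 < a'" "0 < b'" "0 < gcd a b"
    using gcd_lcm_factors[OF assms] .
  have V: "V a = V (gcd a b) \<otimes> V a'" "V b = V (gcd a b) \<otimes> V b'"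
    using V_mult[of "gcd a b" a'] V_mult[of "gcd a b" b'] ab(1,2)[symmetric] assms ab(6,7) by simp_all
  have lcm: "V (lcm a b) = V a \<otimes> V b'" "V (lcm a b) = V b \<otimes> V a'"
    using V_mult[of a b'] V_mult[of b a'] ab(4-7) assms by simp_all
  have "(V a)\<^sup>\<star> \<otimes> V b = (V a')\<^sup>\<star> \<otimes> ((V (gcd a b))\<^sup>\<star> \<otimes> (V (gcd a b) \<otimes> V b'))"
    using ab(6-8) unfolding V by (simp add: adj_mult m_assoc)
  also have "\<dots> = (V a')\<^sup>\<star> \<otimes> V b'"
    using ab(6-8) by (simp add: cancel_left)
  also have "\<dots> = V b' \<otimes> (V a')\<^sup>\<star>"
    using ab(3,6,7) by (intro V_adj_V_coprime)
  finally have "V a \<otimes> (V a)\<^sup>\<star> \<otimes> (V b \<otimes> (V b)\<^sup>\<star>) = V a \<otimes> (V b' \<otimes> (V a')\<^sup>\<star>) \<otimes> (V b)\<^sup>\<star>"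
    using assms ab(6-8) by (simp add: m_assoc) (simp flip: m_assoc)
  also have "\<dots> = (V a \<otimes> V b') \<otimes> (V b \<otimes> V a')\<^sup>\<star>"
    using assms ab(6-8) by (simp add: adj_mult m_assoc)
  finally show ?thesis by (simp only: lcm[symmetric])
qed

fun W :: "nat \<times> nat \<Rightarrow> 'a" where
  "W (m, a) = u [^] m \<otimes> V a"

definition E :: "nat \<Rightarrow> nat \<Rightarrow> 'a" where
  "E m a = W (m, a) \<otimes> (W (m, a))\<^sup>\<star>"

lemma u_pow_u_adj_pow: "u [^] (k::nat) \<otimes> (u [^] k)\<^sup>\<star> = \<one>"
proof (induction k)
  case (Suc k)
  have "u [^] Suc k \<otimes> (u [^] Suc k)\<^sup>\<star> = u [^] k \<otimes> (u \<otimes> u\<^sup>\<star>) \<otimes> (u [^] k)\<^sup>\<star>"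
    by (simp add: adj_mult m_assoc del: u_u_adj)
  then show ?case using Suc by simp
qed simp

lemma E_closed [simp]: "0 < a \<Longrightarrow> E m a \<in> carrier A"
  by (simp add: E_def)

lemma E_adj [simp]: "0 < a \<Longrightarrow> (E m a)\<^sup>\<star> = E m a"
  by (simp add: E_def adj_mult)

text \<open>Shifting \<open>m\<close> by \<open>a k\<close> multiplies \<open>W (m, a)\<close> on the right by the unitary \<open>u\<^sup>k\<close>, which does not
  change the range. Here \<open>k = 1\<close> is allowed, although \<open>1\<close> is not in \<open>P\<close>.\<close>

lemma E_shift: assumes "0 < a" shows "E (m + a * k) a = E m a"
proof -
  have "W (m + a * k, a) = W (m, a) \<otimes> u [^] k"
    using assms by (simp add: V_u_pow m_assoc flip: nat_pow_mult)
  then have "E (m + a * k) a = W (m, a) \<otimes> (u [^] k \<otimes> (u [^] k)\<^sup>\<star>) \<otimes> (W (m, a))\<^sup>\<star>"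
    using assms by (simp add: E_def adj_mult m_assoc del: W.simps) (simp add: adj_mult m_assoc)
  then show ?thesis
    using assms by (simp add: E_def u_pow_u_adj_pow)
qed

lemma E_mult_same: assumes "0 < a" "0 < b" shows "E l a \<otimes> E l b = E l (lcm a b)"
proof -
  have uu: "(u [^] l)\<^sup>\<star> \<otimes> (u [^] l \<otimes> z) = z" if "z \<in> carrier A" for z
    using that isometryD(2)[OF isometry_pow[OF isometry_u, of l]] by (simp add: cancel_left)
  have "E l a \<otimes> E l b
      = u [^] l \<otimes> (V a \<otimes> (V a)\<^sup>\<star> \<otimes> (V b \<otimes> (V b)\<^sup>\<star>)) \<otimes> (u [^] l)\<^sup>\<star>"
    using assms by (simp add: E_def adj_mult m_assoc uu)
  also have "\<dots> = E l (lcm a b)"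
    unfolding V_range_mult[OF assms] using assms by (simp add: E_def adj_mult m_assoc lcm_pos_nat)
  finally show ?thesis .
qed

lemma E_mult_zero:
  assumes "0 < a" "0 < b" "m \<le> n" "\<not> gcd a b dvd n - m" shows "E m a \<otimes> E n b = \<zero>"
proof -
  have "u [^] n = u [^] m \<otimes> u [^] (n - m)"
    using assms(3) by (simp add: nat_pow_mult)
  then have "(u [^] m)\<^sup>\<star> \<otimes> (u [^] n \<otimes> z) = u [^] (n - m) \<otimes> z" if "z \<in> carrier A" for z
    using that isometryD(2)[OF isometry_pow[OF isometry_u, of m]] by (simp add: cancel_left m_assoc)
  then have "E m a \<otimes> E n b
      = u [^] m \<otimes> V a \<otimes> ((V a)\<^sup>\<star> \<otimes> (u [^] (n - m) \<otimes> V b)) \<otimes> (V b)\<^sup>\<star> \<otimes> (u [^] n)\<^sup>\<star>"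
    using assms by (simp add: E_def adj_mult m_assoc)
  then show ?thesis
    using assms V_adj_u_V_zero[of a b "n - m"] by simp
qed

end

text \<open>Bezout gives a common element of the two progressions, and adding a multiple of \<open>a b\<close> to it
  avoids the missing step \<open>1\<close> of \<open>P\<close>.\<close>

lemma translate_meet:
  assumes "0 < a" "0 < b" "m \<le> n" "gcd a b dvd n - m"
  shows "translate m a \<inter> translate n b \<noteq> {}"
proof -
  obtain x y where xy: "a * x = b * y + gcd a b"
    using bezout_nat[of a b] assms(1) by auto
  obtain q where q: "n - m = gcd a b * q"
    using assms(4) by blast
  have "a * (x * q) = b * (y * q) + (n - m)"
    unfolding q using arg_cong[OF xy, of "\<lambda>z. z * q"] by (simp add: algebra_simps)
  then have eq: "m + a * (x * q + 2 * b) = n + b * (y * q + 2 * a)"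
    using assms(3) by (simp add: algebra_simps)
  have "m + a * (x * q + 2 * b) \<in> translate m a"
    unfolding translate_def P_add_def using assms(2) by force
  moreover have "m + a * (x * q + 2 * b) \<in> translate n b"
    unfolding eq translate_def P_add_def using assms(1) by force
  ultimately show ?thesis by blast
qed

lemma pn_join_commute: "pn_join x y = pn_join y x"
  by (cases x; cases y) (simp add: Int_commute lcm.commute)

context cstar_presentation
begin

text \<open>When the translates meet, every common element \<open>l\<close> may replace both \<open>m\<close> and \<open>n\<close>; the least
  one is only a choice.\<close>

lemma E_join_le:
  assumes "0 < a" "0 < b" "m \<le> n"
  shows "E m a \<otimes> E n b =
    (case pn_join (m, a) (n, b) of None \<Rightarrow> \<zero> | Some (l, c) \<Rightarrow> E l c)"
proof (cases "translate m a \<inter> translate n b = {}")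
  case True
  then have "\<not> gcd a b dvd n - m"
    using translate_meet[OF assms] by blast
  then show ?thesis
    using True E_mult_zero[OF assms] by simp
next
  case False
  define l where "l = (LEAST l. l \<in> translate m a \<inter> translate n b)"
  obtain k where "k \<in> translate m a \<inter> translate n b"
    using False by blast
  then have "l \<in> translate m a \<inter> translate n b"
    unfolding l_def by (rule LeastI[of "\<lambda>l. l \<in> translate m a \<inter> translate n b"])
  then have "\<exists>i. l = m + a * i" "\<exists>j. l = n + b * j"
    by (auto simp: translate_def)
  then have "E m a = E l a" "E n b = E l b"
    using E_shift assms by metis+
  then have "E m a \<otimes> E n b = E l (lcm a b)"
    using assms by (simp add: E_mult_same)
  then show ?thesis
    using False by (simp add: l_def)
qed

text \<open>Projections are self-adjoint, so taking adjoints exchanges the two factors.\<close>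

lemma E_join:
  assumes "0 < a" "0 < b"
  shows "E m a \<otimes> E n b =
    (case pn_join (m, a) (n, b) of None \<Rightarrow> \<zero> | Some (l, c) \<Rightarrow> E l c)"
proof (cases "m \<le> n")
  case True
  then show ?thesis by (intro E_join_le assms)
next
  case False
  have "E m a \<otimes> E n b = (E n b \<otimes> E m a)\<^sup>\<star>"
    using assms by (simp add: adj_mult)
  also have "\<dots> = (case pn_join (m, a) (n, b) of None \<Rightarrow> \<zero> | Some (l, c) \<Rightarrow> (E l c)\<^sup>\<star>)"
    using False assms unfolding pn_join_commute[of "(m, a)"]
    by (subst E_join_le) (simp_all del: pn_join.simps split: option.split)
  also have "\<dots> = (case pn_join (m, a) (n, b) of None \<Rightarrow> \<zero> | Some (l, c) \<Rightarrow> E l c)"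
    using assms by (auto simp: lcm_pos_nat)
  finally show ?thesis .
qed

theorem covariant_rep_W: "covariant_rep A W"
  unfolding covariant_rep_def isometric_rep_def
proof (intro conjI ballI)
  fix x y assume xy: "x \<in> PN" "y \<in> PN"
  obtain m a n b where x: "x = (m, a)" "0 < a" and y: "y = (n, b)" "0 < b"
    using xy by (auto simp: PN_def)
  show "isometry_in A (W x)"
    using x by (simp add: isometry_mult isometry_pow isometry_u isometry_V)
  show "W (pn_mult x y) = W x \<otimes> W y"
  proof -
    have "W (pn_mult x y) = u [^] m \<otimes> (u [^] (a * n) \<otimes> V a) \<otimes> V b"
      using x y by (simp add: V_mult m_assoc flip: nat_pow_mult)
    also have "\<dots> = W x \<otimes> W y"
      using x y by (simp add: m_assoc flip: V_u_pow)
    finally show ?thesis .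
  qed
  have "W x \<otimes> (W x)\<^sup>\<star> \<otimes> W y \<otimes> (W y)\<^sup>\<star> = E m a \<otimes> E n b"
    using x y by (simp add: E_def m_assoc)
  also have "\<dots> = (case pn_join x y of None \<Rightarrow> \<zero> | Some (l, c) \<Rightarrow> E l c)"
    unfolding x(1) y(1) by (rule E_join[OF x(2) y(2)])
  also have "\<dots> = (case pn_join x y of None \<Rightarrow> \<zero> | Some z \<Rightarrow> W z \<otimes> (W z)\<^sup>\<star>)"
    by (simp add: E_def split: option.split)
  finally show "W x \<otimes> (W x)\<^sup>\<star> \<otimes> W y \<otimes> (W y)\<^sup>\<star>
      = (case pn_join x y of None \<Rightarrow> \<zero> | Some z \<Rightarrow> W z \<otimes> (W z)\<^sup>\<star>)" .
qed simp

lemma W_generators: "W (2, 1) = s" "W (3, 1) = t" "prime p \<Longrightarrow> W (0, p) = v p"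
  by (simp_all add: u_square u_cube V_prime)

end

section \<open>A covariant representation satisfies the presentation\<close>

lemma pn_join_2_3: "pn_join (2, 1) (3, 1) = Some (5, 1)"
proof -
  have 5: "5 \<in> translate 2 1 \<inter> translate 3 1"
    by (auto simp: translate_def P_add_def intro!: exI[of _ "3::nat"] exI[of _ "2::nat"])
  have "5 \<le> l" if "l \<in> translate 2 1 \<inter> translate 3 1" for l
  proof (rule ccontr)
    assume "\<not> 5 \<le> l"
    then have "l \<in> {0, 1, 2, 3, 4}" by auto
    then show False using that by (auto simp: translate_def P_add_def)
  qed
  with 5 have "(LEAST l. l \<in> translate 2 1 \<inter> translate 3 1) = 5"
    by (rule Least_equality)
  then show ?thesis using 5 by auto
qed

lemma pn_join_0:
  "pn_join (0, a) (0, b) = Some (0, lcm a b)"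
proof -
  have 0: "0 \<in> translate 0 a \<inter> translate 0 b"
    by (auto simp: translate_def P_add_def)
  then have "(LEAST l. l \<in> translate 0 a \<inter> translate 0 b) = 0"
    by (rule Least_equality) simp
  then show ?thesis using 0 by auto
qed

lemma pn_join_None:
  assumes "p dvd b" "\<not> p dvd n" shows "pn_join (0, p) (n, b) = None"
proof -
  have "p dvd n" if "p * k = n + b * j" for k j
    using that assms(1) by (metis dvd_add_left_iff dvd_mult2 dvd_triv_left)
  then show ?thesis using assms by (auto simp: translate_def)
qed

locale covariant_representation = cstar_algebra A
  for A :: "'a cstar" (structure) +
  fixes W :: "nat \<times> nat \<Rightarrow> 'a"
  assumes covariant: "covariant_rep A W"
begin

lemma isometry_W: "x \<in> PN \<Longrightarrow> isometry_in A (W x)"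
  and W_unit: "W (0, 1) = \<one>"
  and W_mult: "\<lbrakk>x \<in> PN; y \<in> PN\<rbrakk> \<Longrightarrow> W x \<otimes> W y = W (pn_mult x y)"
  and W_ranges: "\<lbrakk>x \<in> PN; y \<in> PN\<rbrakk> \<Longrightarrow> W x \<otimes> (W x)\<^sup>\<star> \<otimes> W y \<otimes> (W y)\<^sup>\<star> =
        (case pn_join x y of None \<Rightarrow> \<zero> | Some z \<Rightarrow> W z \<otimes> (W z)\<^sup>\<star>)"
  using covariant by (auto simp: covariant_rep_def isometric_rep_def)

lemma W_closed [simp]: "x \<in> PN \<Longrightarrow> W x \<in> carrier A"
  using isometry_W by (simp add: isometry_in_def)

lemma W_adj_W [simp]: "x \<in> PN \<Longrightarrow> (W x)\<^sup>\<star> \<otimes> W x = \<one>"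
  using isometry_W by (simp add: isometry_in_def)

text \<open>Inserting \<open>(W x)\<^sup>\<star> W x = \<one>\<close> and \<open>(W y)\<^sup>\<star> W y = \<one>\<close> exposes the product of the two range
  projections.\<close>

lemma W_adj_mult:
  assumes "x \<in> PN" "y \<in> PN"
  shows "(W x)\<^sup>\<star> \<otimes> W y =
    (W x)\<^sup>\<star> \<otimes> (case pn_join x y of None \<Rightarrow> \<zero> | Some z \<Rightarrow> W z \<otimes> (W z)\<^sup>\<star>) \<otimes> W y"
proof -
  have "(W x)\<^sup>\<star> \<otimes> W y = ((W x)\<^sup>\<star> \<otimes> W x) \<otimes> ((W x)\<^sup>\<star> \<otimes> W y) \<otimes> ((W y)\<^sup>\<star> \<otimes> W y)"
    using assms by simp
  also have "\<dots> = (W x)\<^sup>\<star> \<otimes> (W x \<otimes> (W x)\<^sup>\<star> \<otimes> W y \<otimes> (W y)\<^sup>\<star>) \<otimes> W y"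
    using assms by (simp add: m_assoc del: W_adj_W)
  finally show ?thesis
    by (simp only: W_ranges[OF assms])
qed

lemma W_adj_mult_None:
  "\<lbrakk>x \<in> PN; y \<in> PN; pn_join x y = None\<rbrakk> \<Longrightarrow> (W x)\<^sup>\<star> \<otimes> W y = \<zero>"
  using W_adj_mult[of x y] by simp

lemma W_adj_mult_Some:
  assumes "x \<in> PN" "y \<in> PN" "x' \<in> PN" "y' \<in> PN"
    and z: "pn_join x y = Some z" "pn_mult x x' = z" "pn_mult y y' = z"
  shows "(W x)\<^sup>\<star> \<otimes> W y = W x' \<otimes> (W y')\<^sup>\<star>"
proof -
  have "W z \<otimes> (W z)\<^sup>\<star> = W (pn_mult x x') \<otimes> (W (pn_mult y y'))\<^sup>\<star>"
    by (simp add: z)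
  also have "\<dots> = W x \<otimes> W x' \<otimes> ((W y')\<^sup>\<star> \<otimes> (W y)\<^sup>\<star>)"
    using assms(1-4) by (simp add: adj_mult flip: W_mult)
  finally have "(W x)\<^sup>\<star> \<otimes> W y = (W x)\<^sup>\<star> \<otimes> (W x \<otimes> W x' \<otimes> ((W y')\<^sup>\<star> \<otimes> (W y)\<^sup>\<star>)) \<otimes> W y"
    using W_adj_mult[OF assms(1,2)] by (simp add: z(1))
  also have "\<dots> = ((W x)\<^sup>\<star> \<otimes> W x) \<otimes> W x' \<otimes> ((W y')\<^sup>\<star> \<otimes> ((W y)\<^sup>\<star> \<otimes> W y))"
    using assms(1-4) by (simp add: m_assoc del: W_adj_W)
  also have "\<dots> = W x' \<otimes> (W y')\<^sup>\<star>"
    using assms(1-4) by simp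
  finally show ?thesis .
qed

definition s :: 'a where "s = W (2, 1)"
definition t :: 'a where "t = W (3, 1)"
definition v :: "nat \<Rightarrow> 'a" where "v p = W (0, p)"

lemma PN_I: "\<lbrakk>m \<noteq> 1; 0 < a\<rbrakk> \<Longrightarrow> (m, a) \<in> PN"
  by (simp add: PN_def P_add_def)

lemma isometry_generators:
  "isometry_in A s" "isometry_in A t" "prime p \<Longrightarrow> isometry_in A (v p)"
  by (auto simp: s_def t_def v_def intro!: isometry_W PN_I prime_gt_0_nat)

lemmas generator_simps [simp] =
  isometryD[OF isometry_generators(1)] isometryD[OF isometry_generators(2)]
  isometryD[OF isometry_generators(3)]

lemma s_pow: "s [^] (k::nat) = W (2 * k, 1)"
proof (induction k)
  case (Suc k)
  then show ?case
    using W_mult[of "(2 * k, 1)" "(2, 1)"] by (simp add: PN_I s_def)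
qed (simp add: W_unit[simplified])

lemma t_pow: "t [^] (k::nat) = W (3 * k, 1)"
proof (induction k)
  case (Suc k)
  then show ?case
    using W_mult[of "(3 * k, 1)" "(3, 1)"] by (simp add: PN_I t_def add.commute)
qed (simp add: W_unit[simplified])

lemma pow_mult_v:
  assumes "0 < p" shows "s [^] i \<otimes> t [^] j \<otimes> v p = W (2 * i + 3 * j, p)"
proof -
  have ne: "2 * i \<noteq> 1" "3 * j \<noteq> 1" "2 * i + 3 * j \<noteq> 1"
    by presburger+
  have "s [^] i \<otimes> t [^] j = W (2 * i + 3 * j, 1)"
    using W_mult[of "(2 * i, 1)" "(3 * j, 1)"] ne by (simp add: PN_I s_pow t_pow)
  then show ?thesis
    using W_mult[of "(2 * i + 3 * j, 1)" "(0, p)"] ne assms by (simp add: PN_I v_def)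
qed

lemma t_square_eq_s_cube: "t [^] (2::nat) = s [^] (3::nat)"
  by (simp add: s_pow t_pow)

lemma ts: "t \<otimes> s = s \<otimes> t"
  by (simp add: s_def t_def W_mult PN_I)

lemma s_adj_t: "s\<^sup>\<star> \<otimes> t = t \<otimes> s\<^sup>\<star>"
  unfolding s_def t_def
  by (rule W_adj_mult_Some[OF _ _ _ _ pn_join_2_3]) (simp_all add: PN_I)

lemma t_adj_s: "t\<^sup>\<star> \<otimes> s = s \<otimes> t\<^sup>\<star>"
proof -
  have "t\<^sup>\<star> \<otimes> s = (s\<^sup>\<star> \<otimes> t)\<^sup>\<star>" by (simp add: adj_mult)
  also have "\<dots> = s \<otimes> t\<^sup>\<star>" unfolding s_adj_t by (simp add: adj_mult)
  finally show ?thesis .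
qed

lemmas unitary = unitary_from_cube_relation[OF isometry_generators(1,2) t_square_eq_s_cube t_adj_s]
lemmas t_t_adj [simp] = unitary(1)
lemmas s_s_adj [simp] = unitary(2)

lemma v_s: assumes "prime p" shows "v p \<otimes> s = s [^] p \<otimes> v p"
  using assms prime_gt_0_nat[OF assms] pow_mult_v[of p p 0] W_mult[of "(0, p)" "(2, 1)"]
  by (simp add: PN_I s_def[simplified, symmetric] v_def[symmetric] mult.commute)

lemma v_t: assumes "prime p" shows "v p \<otimes> t = t [^] p \<otimes> v p"
  using assms prime_gt_0_nat[OF assms] pow_mult_v[of p 0 p] W_mult[of "(0, p)" "(3, 1)"]
  by (simp add: PN_I t_def[simplified, symmetric] v_def[symmetric] mult.commute)

lemma v_adj_zero:
  assumes "0 < p" "p dvd b" "0 < b" "\<not> p dvd n" "n \<noteq> 1" shows "(v p)\<^sup>\<star> \<otimes> W (n, b) = \<zero>"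
  unfolding v_def using assms by (intro W_adj_mult_None pn_join_None PN_I) auto

lemma v_compress_not_dvd:
  assumes p: "prime p" and k: "\<not> p dvd 2 * i + 3 * j"
  shows "(v p)\<^sup>\<star> \<otimes> s [^] i \<otimes> t [^] j \<otimes> v p = \<zero>"
proof -
  have "2 * i + 3 * j \<noteq> 1" by presburger
  then show ?thesis
    using v_adj_zero[of p p "2 * i + 3 * j"] pow_mult_v[of p i j] p k
    by (simp add: m_assoc prime_gt_0_nat)
qed

text \<open>Inserting \<open>s s\<^sup>\<star> = \<one>\<close> to the right of \<open>v p\<close> and moving \<open>s\<close> to the left produces a factor
  \<open>s\<^sup>p\<close>, which can absorb negative powers of \<open>s\<close> in \<open>x\<close>.\<close>

lemma mult_v_via_s_pow:
  assumes p: "prime p" and x: "x \<in> carrier A" "y \<in> carrier A" and y: "x \<otimes> s [^] p = y"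
  shows "x \<otimes> v p = y \<otimes> v p \<otimes> s\<^sup>\<star>"
proof -
  have "x \<otimes> v p = x \<otimes> (v p \<otimes> s) \<otimes> s\<^sup>\<star>"
    using p x by (simp add: m_assoc)
  also have "\<dots> = (x \<otimes> s [^] p) \<otimes> v p \<otimes> s\<^sup>\<star>"
    unfolding v_s[OF p] using p x by (simp add: m_assoc)
  finally show ?thesis using y by simp
qed

text \<open>Only the join of \<open>(2, 1)\<close> and \<open>(3, 1)\<close>, the joins of \<open>(0, p)\<close> and \<open>(0, q)\<close>, and the
  absence of a join when \<open>p\<close> does not divide the exponent are needed. Everything else is
  computed from the unitarity of \<open>s\<close> and \<open>t\<close> and the intertwining relations.\<close>

lemma relations: "presentation_relations A s t v"
proof
  fix p q :: nat assume p: "prime p" and q: "prime q"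
  show "v p \<otimes> v q = v q \<otimes> v p"
    using p q by (simp add: v_def W_mult PN_I prime_gt_0_nat mult.commute)
  show "(v p)\<^sup>\<star> \<otimes> v q = v q \<otimes> (v p)\<^sup>\<star>" if "p \<noteq> q"
    unfolding v_def using p q that
    by (intro W_adj_mult_Some[OF _ _ _ _ pn_join_0])
       (simp_all add: PN_I prime_gt_0_nat lcm_coprime primes_coprime mult.commute)
next
  fix p :: nat assume p: "prime p"
  show "s\<^sup>\<star> \<otimes> v p = s [^] (p - 1) \<otimes> v p \<otimes> s\<^sup>\<star>"
    using pow_adj_pow[OF isometry_generators(1), of 1 p] p prime_gt_0_nat[OF p]
    by (intro mult_v_via_s_pow) auto
  show "v p \<otimes> s\<^sup>\<star> = (s\<^sup>\<star>) [^] p \<otimes> v p" "v p \<otimes> t\<^sup>\<star> = (t\<^sup>\<star>) [^] p \<otimes> v p"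
    using p by (auto intro!: intertwine_adj isometry_generators v_s v_t)
next
  fix p k1 k2 :: nat assume p: "prime p" and k: "1 \<le> 2 * k1 + 3 * k2" "2 * k1 + 3 * k2 < p"
  then have "\<not> p dvd 2 * k1 + 3 * k2" by (meson dvd_imp_le less_le_trans not_le zero_less_one)
  then show "(v p)\<^sup>\<star> \<otimes> s [^] k1 \<otimes> t [^] k2 \<otimes> v p = \<zero>"
    using p by (rule v_compress_not_dvd[rotated])
next
  fix p k :: nat assume p: "prime p" "1 \<le> k" "k < p"
  then have k: "\<not> p dvd k" by (auto dest: dvd_imp_le)
  show "(v p)\<^sup>\<star> \<otimes> s [^] k \<otimes> v p = \<zero>" if "p \<noteq> 2"
  proof -
    have "\<not> p dvd 2 * k"
      using p(1) k that two_is_prime_nat by (auto simp: prime_dvd_mult_iff primes_dvd_imp_eq)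
    then show ?thesis using v_compress_not_dvd[of p k 0] p by simp
  qed
  show "(v p)\<^sup>\<star> \<otimes> t [^] k \<otimes> v p = \<zero>" if "p \<noteq> 3"
  proof -
    have "\<not> p dvd 3 * k"
      using p(1) k that primes_dvd_imp_eq[of p 3] by (auto simp: prime_dvd_mult_iff)
    then show ?thesis using v_compress_not_dvd[of p 0 k] p by simp
  qed
  (* This turns t^k s*^k v p into W (2p + k, p) s*, and p does not divide 2p + k. *)
  have "(s\<^sup>\<star>) [^] k \<otimes> v p = s [^] (p - k) \<otimes> v p \<otimes> s\<^sup>\<star>"
    using p pow_adj_pow[OF isometry_generators(1), of k p] by (intro mult_v_via_s_pow) auto
  moreover have "t [^] k \<otimes> (s [^] (p - k) \<otimes> v p) = W (2 * p + k, p)"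
  proof -
    have "t [^] k \<otimes> s [^] (p - k) = s [^] (p - k) \<otimes> t [^] k"
      using ts by (simp add: s_pow t_pow W_mult PN_I) (simp add: W_mult PN_I add.commute)
    moreover have "s [^] (p - k) \<otimes> t [^] k \<otimes> v p = W (2 * p + k, p)"
    proof -
      have "2 * (p - k) + 3 * k = 2 * p + k"
        using p by linarith
      then show ?thesis
        using pow_mult_v[of p "p - k" k] prime_gt_0_nat[OF p(1)] by metis
    qed
    ultimately show ?thesis
      using p by (simp flip: m_assoc)
  qed
  moreover have "(v p)\<^sup>\<star> \<otimes> W (2 * p + k, p) = \<zero>"
    using p k by (intro v_adj_zero) (auto simp: dvd_add_right_iff)
  ultimately show "(v p)\<^sup>\<star> \<otimes> t [^] k \<otimes> (s\<^sup>\<star>) [^] k \<otimes> v p = \<zero>"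
    using p W_closed[OF PN_I[of "2 * p + k" p]] by (simp add: m_assoc) (simp flip: m_assoc)
next
  have 2: "prime (2::nat)" and 3: "prime (3::nat)" by simp_all
  (* s v_2 = s s^2 v_2 s* = t^2 v_2 s* = v_2 t s*, and similarly for t v_3. *)
  have "s \<otimes> s [^] (2::nat) = s [^] (3::nat)"
    by (simp add: numeral_2_eq_2 numeral_3_eq_3 m_assoc)
  then have "s \<otimes> v 2 = t [^] (2::nat) \<otimes> v 2 \<otimes> s\<^sup>\<star>"
    by (intro mult_v_via_s_pow[OF 2]) (simp_all only: t_square_eq_s_cube generator_simps nat_pow_closed)
  then have "s \<otimes> v 2 = v 2 \<otimes> (t \<otimes> s\<^sup>\<star>)"
    using 2 by (simp add: v_t[OF 2, symmetric] m_assoc)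
  then show "(v 2)\<^sup>\<star> \<otimes> s \<otimes> v 2 = t \<otimes> s\<^sup>\<star>"
    using 2 by (simp add: m_assoc cancel_left)
  have "t \<otimes> t [^] (2::nat) = t [^] (3::nat)"
    by (simp add: numeral_2_eq_2 numeral_3_eq_3 m_assoc)
  then have "t \<otimes> v 3 = t [^] (3::nat) \<otimes> v 3 \<otimes> s\<^sup>\<star>"
    by (intro mult_v_via_s_pow[OF 3]) (simp_all only: t_square_eq_s_cube[symmetric] generator_simps nat_pow_closed)
  then have "t \<otimes> v 3 = v 3 \<otimes> (t \<otimes> s\<^sup>\<star>)"
    using 3 by (simp add: v_t[OF 3, symmetric] m_assoc)
  then show "(v 3)\<^sup>\<star> \<otimes> t \<otimes> v 3 = t \<otimes> s\<^sup>\<star>"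
    using 3 by (simp add: m_assoc cancel_left)
  show "(v 3)\<^sup>\<star> \<otimes> t [^] (2::nat) \<otimes> v 3 = s"
    using 3 by (simp add: t_square_eq_s_cube m_assoc cancel_left flip: v_s[OF 3])
qed (simp_all add: isometry_generators t_square_eq_s_cube ts s_adj_t t_adj_s v_s v_t)

end

section \<open>The isomorphism\<close>

text \<open>The semigroup is generated by \<open>(2, 1)\<close>, \<open>(3, 1)\<close> and the \<open>(0, p)\<close>, so a homomorphism is
  determined on all of \<open>W ` PN\<close> by its values at the corresponding isometries. A first coordinate other than \<open>0\<close> and \<open>3\<close> is lowered by \<open>2\<close>;
  for \<open>3\<close> that would lead outside \<open>P\<close>.\<close>

lemma PN_induct_generators:
  assumes "x \<in> PN" "P (0, 1)"
    and "\<And>y. \<lbrakk>y \<in> PN; P y\<rbrakk> \<Longrightarrow> P (pn_mult (2, 1) y)"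
    and "\<And>y. \<lbrakk>y \<in> PN; P y\<rbrakk> \<Longrightarrow> P (pn_mult (3, 1) y)"
    and "\<And>p y. \<lbrakk>prime p; y \<in> PN; P y\<rbrakk> \<Longrightarrow> P (pn_mult (0, p) y)"
  shows "P x"
proof -
  obtain m a where x: "x = (m, a)" "m \<noteq> 1" "0 < a"
    using assms(1) by (auto simp: PN_def P_add_def)
  have "P (m, a)"
    using x(2)
  proof (induction m rule: less_induct)
    case (less m)
    note a = x(3)
    consider "m = 0" | "m = 3" | "m \<noteq> 0" "m \<noteq> 1" "m \<noteq> 3" using less.prems by blast
    then show ?case
    proof cases
      case 1
      show ?thesis
        unfolding 1 using a
      proof (induction a rule: pos_nat_prime_induct)
        case (prime_mult p n)
        then show ?case using assms(5)[of p "(0, n)"] by (simp add: PN_def P_add_def)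
      qed (use assms(2) in simp)
    next
      case 2
      then show ?thesis
        using assms(4)[of "(0, a)"] less.IH[of 0] x(3) by (simp add: PN_def P_add_def)
    next
      case 3
      then have "P (m - 2, a)" "(m - 2, a) \<in> PN"
        using less.IH[of "m - 2"] x(3) by (auto simp: PN_def P_add_def)
      then show ?thesis
        using assms(3)[of "(m - 2, a)"] le_add_diff_inverse[of 2 m] 3 by (simp del: add_2_eq_Suc)
    qed
  qed
  then show ?thesis by (simp add: x)
qed

theorem theorem3p13:
  fixes T :: "'a cstar" and W :: "nat \<times> nat \<Rightarrow> 'a"
    and A :: "'b cstar" and s t :: 'b and v :: "nat \<Rightarrow> 'b"
  assumes "universal_covariant_rep TYPE('b) T W"
    and "universal_presentation TYPE('a) A s t v"
  shows "\<exists>\<pi>\<in>star_iso T A. \<pi> (W (2, 1)) = s \<and> \<pi> (W (3, 1)) = t \<and>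
           (\<forall>p. prime p \<longrightarrow> \<pi> (W (0, p)) = v p)"
proof -
  have T: "cstar_algebra T" "covariant_rep T W" "carrier T = cstar_generated T (W ` PN)"
    and A: "cstar_algebra A" "presentation_relations A s t v"
      "carrier A = cstar_generated A ({s, t} \<union> v ` {p. prime p})"
    using assms by (auto simp: universal_covariant_rep_def universal_presentation_def)
  interpret T: covariant_representation T W
    using T(1,2) by (simp add: covariant_representation_def covariant_representation_axioms_def)
  interpret A: cstar_presentation A s t v
    using A(1,2) by (simp add: cstar_presentation_def)
  have "\<exists>\<pi>\<in>star_hom T A. \<pi> ` carrier T \<subseteq> cstar_generated A (A.W ` PN) \<and>
      (\<forall>x\<in>PN. \<pi> (W x) = A.W x)"
    using assms(1)[unfolded universal_covariant_rep_def, THEN conjunct2, THEN conjunct2,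
        THEN conjunct2, THEN spec, THEN spec, THEN mp, OF conjI, OF A(1) A.covariant_rep_W] .
  then obtain \<pi> where \<pi>: "\<pi> \<in> star_hom T A" "\<And>x. x \<in> PN \<Longrightarrow> \<pi> (W x) = A.W x"
    by blast
  have "\<exists>\<rho>\<in>star_hom A T. \<rho> s = T.s \<and> \<rho> t = T.t \<and> (\<forall>p. prime p \<longrightarrow> \<rho> (v p) = T.v p)"
    using assms(2)[unfolded universal_presentation_def, THEN conjunct2, THEN conjunct2,
        THEN conjunct2, THEN spec, THEN spec, THEN spec, THEN spec, THEN mp, OF conjI,
        OF T(1) T.relations] .
  then obtain \<rho> where \<rho>: "\<rho> \<in> star_hom A T" "\<rho> s = T.s" "\<rho> t = T.t"
      "\<And>p. prime p \<Longrightarrow> \<rho> (v p) = T.v p"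
    by blast
  have gen: "\<pi> (W (2, 1)) = s" "\<pi> (W (3, 1)) = t" "\<And>p. prime p \<Longrightarrow> \<pi> (W (0, p)) = v p"
    using A.W_generators by (simp_all add: \<pi>(2) T.PN_I prime_gt_0_nat del: A.W.simps)
  have id: "(\<lambda>x. x) \<in> star_hom B B" for B :: "'c cstar"
    by (auto simp: star_hom_def ring_hom_def)
  have gens: "\<rho> (\<pi> (W (2, 1))) = W (2, 1)" "\<rho> (\<pi> (W (3, 1))) = W (3, 1)"
      "\<And>p. prime p \<Longrightarrow> \<rho> (\<pi> (W (0, p))) = W (0, p)"
    by (simp_all only: gen \<rho> T.s_def T.t_def T.v_def)
  have "\<rho> (\<pi> (W x)) = W x" if "x \<in> PN" for x
    using that
  proof (rule PN_induct_generators)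
    have step: "\<rho> (\<pi> (W (pn_mult g y))) = W (pn_mult g y)"
      if "g \<in> PN" "y \<in> PN" "\<rho> (\<pi> (W g)) = W g" "\<rho> (\<pi> (W y)) = W y" for g y
      using that star_homD(2,3)[OF \<pi>(1)] star_homD(3)[OF \<rho>(1)] by (simp flip: T.W_mult)
    show "\<rho> (\<pi> (W (0, 1))) = W (0, 1)"
      using star_homD(5)[OF \<pi>(1)] star_homD(5)[OF \<rho>(1)] by (simp add: T.W_unit[simplified])
    show "\<rho> (\<pi> (W (pn_mult (2, 1) y))) = W (pn_mult (2, 1) y)"
      "\<rho> (\<pi> (W (pn_mult (3, 1) y))) = W (pn_mult (3, 1) y)"
      if "y \<in> PN" "\<rho> (\<pi> (W y)) = W y" for y
      using that by (intro step T.PN_I gens; simp)+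
    show "\<rho> (\<pi> (W (pn_mult (0, p) y))) = W (pn_mult (0, p) y)"
      if "prime p" "y \<in> PN" "\<rho> (\<pi> (W y)) = W y" for p y
      using that by (intro step T.PN_I gens) (simp_all add: prime_gt_0_nat)
  qed
  then have left: "\<rho> (\<pi> y) = y" if "y \<in> carrier T" for y
    using star_hom_eq_on_generated[OF T(1) T(1) star_hom_comp[OF \<pi>(1) \<rho>(1)] id, of "W ` PN" y]
      that[unfolded T(3)] T.W_closed by fastforce
  have gens': "\<pi> (\<rho> g) = g" if "g \<in> {s, t} \<union> v ` {p. prime p}" for g
    using that by (auto simp only: Un_iff insert_iff empty_iff image_iff mem_Collect_eq
        \<rho> gen T.s_def T.t_def T.v_def)
  have right: "\<pi> (\<rho> y) = y" if "y \<in> carrier A" for y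
    using star_hom_eq_on_generated[OF A(1) A(1) star_hom_comp[OF \<rho>(1) \<pi>(1)] id,
        of "{s, t} \<union> v ` {p. prime p}" y] that[unfolded A(3)] gens' by fastforce
  have "bij_betw \<pi> (carrier T) (carrier A)"
    using left right star_homD(2)[OF \<pi>(1)] star_homD(2)[OF \<rho>(1)]
    by (intro bij_betw_byWitness[of _ \<rho>]) auto
  then show ?thesis
    using \<pi>(1) gen by (auto simp: star_iso_def)
qed

end
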